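(* For any admissible $v>1$ (that is, any $v>1$ such that a $(K_v,C_4)$-design exists), $$\mathcal{L}_1C_4(v)=\{n\geq v\mid n\equiv 0,1\pmod 3\}$$ and $$\{n\geq v+2\mid n\equiv 0,1\pmod 3\}\subseteq\mathcal{L}_2C_4(v)\subseteq\{n\geq v\mid n\equiv 0,1\pmod 3\}.$$
   Context: Graphs are finite and simple; $\Gamma'\leq\Gamma$ means that $\Gamma'$ is (isomorphic to) a subgraph of $\Gamma$. $K_n$ is the complete graph on $n$ vertices, $C_4$ is the cycle of length $4$, and $P_4$ is the path with $4$ vertices and $3$ edges. For graphs $\Gamma\leq K$, a $(K,\Gamma)$-design is a set of subgraphs of $K$, called blocks, each isomorphic to $\Gamma$, whose edge sets partition $E(K)$. A $(K_v,\Gamma)$-design is also called a $\Gamma$-design of order $v$. Given a $(K,\Gamma)$-design $\mathcal B$ and a $(K',\Gamma')$-design $\mathcal B'$ with $\Gamma'\leq\Gamma$, a down-link from $\mathcal B$ to $\mathcal B'$ is a function $f:\mathcal B\to\mathcal B'$ such that, for every $B\in\mathcal B$, $f(B)$ is a subgraph of $B$ (as an actual graph on the given vertices, not merely up to isomorphism). The complete graphs $K=K_v$ and $K'=K_n$ may have different vertex sets. When such an $f$ exists, $\mathcal B$ is said to be down-linked to $\mathcal B'$. Throughout, the target graph is $\Gamma'=P_4$. $\mathcal{L}_1\Gamma(v)$ is the set of all integers $n$ such that there exists some $\Gamma$-design of order $v$ that can be down-linked to some $P_4$-design of order $n$. $\mathcal{L}_2\Gamma(v)$ is the set of all integers $n$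 such that every $\Gamma$-design of order $v$ can be down-linked to some $P_4$-design of order $n$. Here these are used with $\Gamma=C_4$. *)

theory Defs
  imports Main "HOL-Library.Disjoint_Sets" "HOL-Library.Infinite_Typeclass"
begin

record 'a graph =
  verts :: "'a set"
  edges :: "'a set set"

definition simple_graph :: "'a graph \<Rightarrow> bool" where
  "simple_graph G \<longleftrightarrow> finite (verts G) \<and> (\<forall>e\<in>edges G. e \<subseteq> verts G \<and> card e = 2)"

definition subgraph :: "'a graph \<Rightarrow> 'a graph \<Rightarrow> bool" where
  "subgraph H G \<longleftrightarrow> simple_graph H \<and> simple_graph G \<and> verts H \<subseteq> verts G \<and> edges H \<subseteq> edges G"

definition isomorphic :: "'a graph \<Rightarrow> 'b graph \<Rightarrow> bool" where
  "isomorphic G H \<longleftrightarrow>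
     (\<exists>f. bij_betw f (verts G) (verts H) \<and> edges H = (\<lambda>e. f ` e) ` edges G)"

text \<open>The relation written \<open>\<Gamma>' \<le> \<Gamma>\<close> in the literature: \<open>\<Gamma>'\<close> is isomorphic to a subgraph of \<open>\<Gamma>\<close>.\<close>

definition embeds :: "'b graph \<Rightarrow> 'a graph \<Rightarrow> bool" where
  "embeds \<Gamma>' \<Gamma> \<longleftrightarrow> (\<exists>H. subgraph H \<Gamma> \<and> isomorphic H \<Gamma>')"

definition complete_graph :: "'a set \<Rightarrow> 'a graph" where
  "complete_graph V = \<lparr>verts = V, edges = {e. e \<subseteq> V \<and> card e = 2}\<rparr>"

definition path_graph :: "nat \<Rightarrow> nat graph" where
  "path_graph n = \<lparr>verts = {..<n}, edges = {{i, Suc i} | i. Suc i < n}\<rparr>"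

text \<open>A simple graph only for \<open>n \<ge> 3\<close>.\<close>

definition cycle_graph :: "nat \<Rightarrow> nat graph" where
  "cycle_graph n = \<lparr>verts = {..<n}, edges = {{i, Suc i mod n} | i. i < n}\<rparr>"

text \<open>\<open>P\<^sub>4\<close> has four vertices and three edges.\<close>

abbreviation P4 :: "nat graph" where
  "P4 \<equiv> path_graph 4"

abbreviation C4 :: "nat graph" where
  "C4 \<equiv> cycle_graph 4"

definition is_design :: "'a graph \<Rightarrow> 'b graph \<Rightarrow> 'a graph set \<Rightarrow> bool" where
  "is_design K \<Gamma> \<B> \<longleftrightarrow>
     embeds \<Gamma> K \<and>
     (\<forall>B\<in>\<B>. subgraph B K \<and> isomorphic B \<Gamma>) \<and>
     disjoint_family_on edges \<B> \<and>
     (\<Union>B\<in>\<B>. edges B) = edges K"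

definition design_of_order :: "nat \<Rightarrow> 'b graph \<Rightarrow> 'a graph set \<Rightarrow> bool" where
  "design_of_order v \<Gamma> \<B> \<longleftrightarrow>
     (\<exists>V. finite V \<and> card V = v \<and> is_design (complete_graph V) \<Gamma> \<B>)"

definition down_link :: "('a graph \<Rightarrow> 'a graph) \<Rightarrow> 'a graph set \<Rightarrow> 'a graph set \<Rightarrow> bool" where
  "down_link f \<B> \<B>' \<longleftrightarrow> (\<forall>B\<in>\<B>. f B \<in> \<B>' \<and> subgraph (f B) B)"

definition down_linked :: "'a graph set \<Rightarrow> 'a graph set \<Rightarrow> bool" where
  "down_linked \<B> \<B>' \<longleftrightarrow> (\<exists>f. down_link f \<B> \<B>')"

text \<open>
  The spectra below concern designs whose vertex sets are arbitrary finite subsets of the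
  type \<open>'a\<close>. The vertex sets of the two designs need not be related. The type should be
  infinite, so that complete graphs of every order exist and fresh vertices are never lacking.
  The graph \<open>\<Gamma>\<close> is meant to satisfy \<open>embeds P4 \<Gamma>\<close>.
\<close>

definition L1 :: "'a::infinite itself \<Rightarrow> 'b graph \<Rightarrow> nat \<Rightarrow> nat set" where
  "L1 _ \<Gamma> v = {n. \<exists>(\<B> :: 'a graph set) \<B>'.
     design_of_order v \<Gamma> \<B> \<and> design_of_order n P4 \<B>' \<and> down_linked \<B> \<B>'}"

definition L2 :: "'a::infinite itself \<Rightarrow> 'b graph \<Rightarrow> nat \<Rightarrow> nat set" where
  "L2 _ \<Gamma> v = {n. \<forall>\<B> :: 'a graph set. design_of_order v \<Gamma> \<B> \<longrightarrow>
     (\<exists>\<B>'. design_of_order n P4 \<B>' \<and> down_linked \<B> \<B>')}"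

lemma P4_embeds_C4: "embeds P4 C4"
proof -
  have E: "edges P4 \<subseteq> edges C4"
  proof
    fix e assume "e \<in> edges P4"
    then obtain i where "e = {i, Suc i}" and "Suc i < 4"
      by (auto simp: path_graph_def)
    then have "e = {i, Suc i mod 4}" and "i < 4" by simp_all
    then show "e \<in> edges C4" by (auto simp: cycle_graph_def)
  qed
  have C: "simple_graph C4"
    unfolding simple_graph_def
  proof (intro conjI ballI)
    fix e assume "e \<in> edges C4"
    then obtain i where e: "e = {i, Suc i mod 4}" and i: "i < 4"
      by (auto simp: cycle_graph_def)
    have "Suc i mod 4 < 4" "Suc i mod 4 \<noteq> i" using i by presburger+
    then show "e \<subseteq> verts C4" "card e = 2"
      using e i by (simp_all add: cycle_graph_def)
  qed (simp add: cycle_graph_def)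
  then have "subgraph P4 C4"
    using E unfolding subgraph_def simple_graph_def
    by (auto simp: path_graph_def cycle_graph_def)
  moreover have "isomorphic P4 P4"
    unfolding isomorphic_def by (intro exI[of _ id]) simp
  ultimately show ?thesis unfolding embeds_def by blast
qed

end

theory Submission imports Defs begin

text \<open>
  Idea. Delete one edge from every block of the \<open>C\<^sub>4\<close>-design; what remains of a block is its image under
  the down-link. It remains to choose the deleted edges such that, together with the edges of
  \<open>K\<^sub>n\<close> outside \<open>K\<^sub>v\<close>, they decompose into copies of \<open>P\<^sub>4\<close>. For \<open>n \<ge> v + 2\<close> this is possible for
  every design: a greedy argument disposes of all blocks except some that own pairwise distinct
  vertices (heads), and the edges deleted from these are pendant edges at the heads, which small
  gadgets combine with the edges from two new vertices \<open>x\<close>, \<open>y\<close> to the old ones. Divisibility by \<open>3\<close>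
  decides which number of new vertices works, and three (or, if \<open>n \<equiv> 1\<close>, two) further vertices can
  always be added. For \<open>n \<in> {v, v + 1}\<close> a cyclic design over the integers modulo \<open>v = 8k + 1\<close> is used.
  Conversely, \<open>P\<^sub>4\<close> spans \<open>C\<^sub>4\<close>, so a down-link forces \<open>n \<ge> v\<close>.
\<close>

section \<open>Decompositions into paths with three edges\<close>

text \<open>The greedy argument leaves a set \<open>R\<close> of blocks over which there is no
  control, so everything rests on the little that is known about it. Heads are distinct vertices, so
  \<open>card R\<close> is at most the order v. Blocks are absorbed in threes, so
  \<open>card R\<close> is congruent modulo 3 to the initial number of blocks, and the number of
  vertices that are not heads has a known residue. Each block has two edges at its head, so the
  deleted edge can avoid one prescribed vertex; with the disjointness of the blocks this suffices
  for all gadgets. The remaining obstacle is parity. Two heads form a gadget with x and y alone, but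
  a single head has to be combined with vertices that are not heads. An odd number of heads is
  therefore harmful only if no other vertex is left. Admissible orders v = 8k + 1 are odd, which is
  why a vertex q is set aside (three new vertices) or kept from being a head (four); with two new
  vertices the residue itself provides a vertex that is not a head.\<close>

inductive P4dec :: "'a set set \<Rightarrow> bool" where
  P4dec_empty: "P4dec {}"
| P4dec_insert: "P4dec E \<Longrightarrow> distinct [a, b, c, d] \<Longrightarrow> {{a, b}, {b, c}, {c, d}} \<inter> E = {} \<Longrightarrow>
    P4dec ({{a, b}, {b, c}, {c, d}} \<union> E)"

definition is_P4 :: "'a set set \<Rightarrow> bool" where
  "is_P4 P \<longleftrightarrow> (\<exists>a b c d. distinct [a, b, c, d] \<and> P = {{a, b}, {b, c}, {c, d}})"

definition is_C4 :: "'a set set \<Rightarrow> bool" where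
  "is_C4 B \<longleftrightarrow> (\<exists>a b c d. distinct [a, b, c, d] \<and> B = {{a, b}, {b, c}, {c, d}, {d, a}})"

lemma is_P4I: "distinct [a, b, c, d] \<Longrightarrow> is_P4 {{a, b}, {b, c}, {c, d}}"
  unfolding is_P4_def by (intro exI conjI) (assumption, rule refl)

lemma P4dec_Un:
  assumes "P4dec E" "P4dec F" "E \<inter> F = {}"
  shows "P4dec (E \<union> F)"
  using assms
proof (induction rule: P4dec.induct)
  case (P4dec_insert E a b c d)
  have "P4dec ({{a, b}, {b, c}, {c, d}} \<union> (E \<union> F))"
  proof (rule P4dec.P4dec_insert)
    show "P4dec (E \<union> F)" using P4dec_insert.IH P4dec_insert.prems by fast
    show "{{a, b}, {b, c}, {c, d}} \<inter> (E \<union> F) = {}"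
      using P4dec_insert.hyps(3) P4dec_insert.prems(2) by (simp only: Int_Un_distrib Int_Un_distrib2 Un_empty)
  qed (rule P4dec_insert.hyps(2))
  then show ?case by (simp add: Un_assoc)
qed simp

lemma P4dec_Union:
  assumes "finite I" "\<And>i. i \<in> I \<Longrightarrow> P4dec (E i)" "disjoint_family_on E I"
  shows "P4dec (\<Union>i\<in>I. E i)"
  using assms
proof (induction rule: finite_induct)
  case (insert i I)
  have "P4dec (E i \<union> (\<Union>i\<in>I. E i))"
  proof (rule P4dec_Un)
    show "P4dec (\<Union>i\<in>I. E i)"
      using insert by (auto simp: disjoint_family_on_def)
    show "E i \<inter> (\<Union>i\<in>I. E i) = {}"
      using insert by (auto simp: disjoint_family_on_def)
  qed (use insert in auto)
  then show ?case by simp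
qed (simp add: P4dec_empty)

fun path_edges :: "'a \<times> 'a \<times> 'a \<times> 'a \<Rightarrow> 'a set list" where
  "path_edges (a, b, c, d) = [{a, b}, {b, c}, {c, d}]"

lemma P4dec_paths:
  assumes "\<And>a b c d. (a, b, c, d) \<in> set ps \<Longrightarrow> distinct [a, b, c, d]"
    and "distinct (concat (map path_edges ps))"
  shows "P4dec (set (concat (map path_edges ps)))"
  using assms
proof (induction ps)
  case (Cons p ps)
  obtain a b c d where p: "p = (a, b, c, d)" by (cases p)
  have "P4dec ({{a, b}, {b, c}, {c, d}} \<union> set (concat (map path_edges ps)))"
  proof (rule P4dec_insert)
    show "P4dec (set (concat (map path_edges ps)))"
      by (rule Cons.IH) (use Cons.prems in auto)
    have "set (path_edges p) \<inter> set (concat (map path_edges ps)) = {}"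
      using Cons.prems(2) by simp
    then show "{{a, b}, {b, c}, {c, d}} \<inter> set (concat (map path_edges ps)) = {}"
      unfolding p by (simp only: path_edges.simps list.set)
    show "distinct [a, b, c, d]" by (rule Cons.prems(1)) (simp add: p)
  qed
  moreover have "set (concat (map path_edges (p # ps))) =
      {{a, b}, {b, c}, {c, d}} \<union> set (concat (map path_edges ps))"
    unfolding p by simp
  ultimately show ?case by simp
qed (simp add: P4dec_empty)

text \<open>The form used for explicit gadgets: distinctness of the concatenated edge list states in
  one condition, accessible to the simplifier, that the listed paths share no edge.\<close>

lemma P4dec_pathsI:
  assumes "set (concat (map path_edges ps)) = E"
    and "\<forall>(a, b, c, d) \<in> set ps. distinct [a, b, c, d]"
    and "distinct (concat (map path_edges ps))"
  shows "P4dec E"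
  using P4dec_paths[of ps] assms by blast

lemma P4_card:
  assumes "distinct [a, b, c, d]"
  shows "card {{a, b}, {b, c}, {c, d}} = 3"
proof -
  have "{a, b} \<noteq> {b, c}" "{a, b} \<noteq> {c, d}" "{b, c} \<noteq> {c, d}"
    using assms by (auto simp: doubleton_eq_iff)
  then show ?thesis by simp
qed

lemma P4dec_card:
  "P4dec E \<Longrightarrow> finite E \<and> 3 dvd card E"
proof (induction rule: P4dec.induct)
  case (P4dec_insert E a b c d)
  have "card ({{a, b}, {b, c}, {c, d}} \<union> E) = 3 + card E"
    using P4dec_insert P4_card[of a b c d] by (subst card_Un_disjoint) auto
  then show ?case using P4dec_insert by simp
qed simp

text \<open>The paths in \<open>PP\<close> later become those blocks of the \<open>P4\<close>-design
  that are not images under the down-link.\<close>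

lemma P4dec_partition:
  assumes "P4dec E"
  obtains PP where "\<forall>P\<in>PP. is_P4 P" "disjoint PP" "\<Union>PP = E"
proof -
  have "\<exists>PP. (\<forall>P\<in>PP. is_P4 P) \<and> disjoint PP \<and> \<Union>PP = E"
    using assms
  proof (induction rule: P4dec.induct)
    case P4dec_empty
    show ?case by (rule exI[of _ "{}"]) (simp add: disjoint_def)
  next
    case (P4dec_insert E a b c d)
    obtain PP where PP: "\<forall>P\<in>PP. is_P4 P" "disjoint PP" "\<Union>PP = E"
      using P4dec_insert.IH by blast
    let ?P = "{{a, b}, {b, c}, {c, d}}"
    have *: "disjoint (insert Q PP)" if "Q \<inter> E = {}" for Q
      using PP(2,3) that unfolding disjoint_def by blast
    show ?case
    proof (intro exI[of _ "insert ?P PP"] conjI)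
      show "\<forall>P\<in>insert ?P PP. is_P4 P"
        using PP(1) is_P4I[OF P4dec_insert.hyps(2)] by (simp only: insert_iff ball_simps simp_thms)
      show "disjoint (insert ?P PP)"
        by (rule *) (rule P4dec_insert.hyps(3))
      show "\<Union>(insert ?P PP) = ?P \<union> E" using PP(3) by simp
    qed
  qed
  then show ?thesis using that by blast
qed

section \<open>Edges of a 4-cycle at a vertex and away from it\<close>

lemma is_C4E:
  assumes "is_C4 B"
  obtains a b c d where "distinct [a, b, c, d]" "B = {{a, b}, {b, c}, {c, d}, {d, a}}"
  using assms unfolding is_C4_def by (elim exE conjE) (rule that)

lemma C4_at_vertex:
  assumes "is_C4 B" "a \<in> \<Union>B"
  obtains b c d where "distinct [a, b, c, d]" "B = {{a, b}, {b, c}, {c, d}, {d, a}}"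
proof -
  obtain s t u w where d: "distinct [s, t, u, w]" and B: "B = {{s, t}, {t, u}, {u, w}, {w, s}}"
    using is_C4E[OF assms(1)] .
  have "B = {{t, u}, {u, w}, {w, s}, {s, t}}" "B = {{u, w}, {w, s}, {s, t}, {t, u}}"
    "B = {{w, s}, {s, t}, {t, u}, {u, w}}"
    unfolding B by (simp_all only: insert_commute)
  moreover have "distinct [t, u, w, s]" "distinct [u, w, s, t]" "distinct [w, s, t, u]"
    using d by simp_all metis+
  moreover have "a = s \<or> a = t \<or> a = u \<or> a = w" using B assms(2) by simp blast
  ultimately show ?thesis using d B that by metis
qed

lemma C4_two_neighbours:
  assumes "is_C4 B" "a \<in> \<Union>B"
  obtains p q where "p \<noteq> q" "p \<noteq> a" "q \<noteq> a" "{e \<in> B. a \<in> e} = {{a, p}, {a, q}}"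
proof -
  obtain b c d where d: "distinct [a, b, c, d]" and B: "B = {{a, b}, {b, c}, {c, d}, {d, a}}"
    using C4_at_vertex[OF assms] .
  have "{e \<in> B. a \<in> e} = {{a, b}, {a, d}}" unfolding B using d by (auto simp del: doubleton_eq_iff)
  moreover have "b \<noteq> d" "b \<noteq> a" "d \<noteq> a" using d by auto
  ultimately show ?thesis by (intro that[of b d])
qed

text \<open>Of the two neighbours of \<open>a\<close> on the cycle at least one differs from
  \<open>z\<close>. This single exclusion is all the freedom that a block with head \<open>a\<close>
  offers.\<close>

lemma C4_pendant:
  assumes "is_C4 B" "a \<in> \<Union>B"
  obtains p where "p \<noteq> z" "p \<noteq> a" "{p, a} \<in> B"
proof -
  obtain p q where "p \<noteq> q" "p \<noteq> a" "q \<noteq> a" and pq: "{e \<in> B. a \<in> e} = {{a, p}, {a, q}}"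
    using C4_two_neighbours[OF assms] by metis
  moreover have "{a, p} \<in> B" "{a, q} \<in> B" using pq by blast+
  ultimately show ?thesis using that[of p] that[of q] by (metis insert_commute)
qed

text \<open>Opposite edges of the cycle are disjoint, so \<open>q\<close> misses one of
  them.\<close>

lemma C4_edge_avoiding:
  assumes "is_C4 B"
  obtains a b where "a \<noteq> b" "a \<noteq> q" "b \<noteq> q" "{a, b} \<in> B"
proof -
  obtain s t u w where B: "distinct [s, t, u, w]" "B = {{s, t}, {t, u}, {u, w}, {w, s}}"
    using is_C4E[OF assms] .
  show ?thesis
  proof (cases "q = s \<or> q = t")
    case True then show ?thesis using B by (intro that[of u w]) auto
  next
    case False then show ?thesis using B by (intro that[of s t]) auto
  qed
qed

lemma C4_edge_card:
  assumes "is_C4 B" "e \<in> B"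
  shows "card e = 2"
  using assms unfolding is_C4_def by auto

lemma C4_at_edge:
  assumes "is_C4 B" "e \<in> B"
  obtains a b c d where "distinct [a, b, c, d]" "B = {{a, b}, {b, c}, {c, d}, {d, a}}" "e = {d, a}"
proof -
  obtain a where "a \<in> e" using C4_edge_card[OF assms] by fastforce
  then obtain b c d where d: "distinct [a, b, c, d]" and B: "B = {{a, b}, {b, c}, {c, d}, {d, a}}"
    using C4_at_vertex[OF assms(1), of a] assms(2) by blast
  have "e = {a, b} \<or> e = {d, a}" using assms(2) \<open>a \<in> e\<close> d unfolding B by fastforce
  moreover have "B = {{a, d}, {d, c}, {c, b}, {b, a}}"
    unfolding B by (simp only: insert_commute)
  moreover have "distinct [a, d, c, b]"
    using d by auto
  moreover have "e = {b, a}" if "e = {a, b}" using that by (simp only: insert_commute)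
  ultimately show ?thesis
    using that[of a b c d] that[of a d c b] d B by argo
qed

lemma C4_minus_edge:
  assumes "is_C4 B" "e \<in> B"
  shows "is_P4 (B - {e})" "card B = 4"
proof -
  obtain a b c d where d: "distinct [a, b, c, d]" and B: "B = {{a, b}, {b, c}, {c, d}, {d, a}}"
    and e: "e = {d, a}" using C4_at_edge[OF assms] .
  have *: "e \<notin> {{a, b}, {b, c}, {c, d}}"
    using d unfolding e by (auto simp: doubleton_eq_iff)
  have B2: "B = insert e {{a, b}, {b, c}, {c, d}}"
    unfolding B e by (simp only: insert_commute)
  have "B - {e} = {{a, b}, {b, c}, {c, d}}"
    unfolding B2 by (rule Diff_insert_absorb[OF *])
  then show "is_P4 (B - {e})" using is_P4I[OF d] by simp
  show "card B = 4" unfolding B2 card_insert_disjoint[OF _ *, simplified] P4_card[OF d] by simp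
qed

section \<open>Families of 4-cycles and their heads\<close>

text \<open>
  The edges chosen here are the ones that are deleted from the 4-cycles in \<open>A\<close>; \<open>E\<close> will be a set of
  edges of \<open>K\<^sub>n\<close> outside \<open>K\<^sub>v\<close>.
\<close>

definition absorbs :: "'a set set set \<Rightarrow> 'a set set \<Rightarrow> bool" where
  "absorbs A E \<longleftrightarrow> (\<exists>e. (\<forall>B\<in>A. e B \<in> B) \<and> P4dec (e ` A \<union> E))"

lemma absorbs_empty [simp]: "absorbs {} E \<longleftrightarrow> P4dec E"
  by (simp add: absorbs_def)

locale c4_family =
  fixes V :: "'a set" and BB :: "'a set set set"
  assumes finite_V: "finite V" and finite_BB: "finite BB"
    and C4: "B \<in> BB \<Longrightarrow> is_C4 B"
    and sub_V: "B \<in> BB \<Longrightarrow> \<Union>B \<subseteq> V"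
    and disj: "disjoint BB"
begin

lemma block_unique: "e \<in> B \<Longrightarrow> e \<in> D \<Longrightarrow> B \<in> BB \<Longrightarrow> D \<in> BB \<Longrightarrow> B = D"
  using disj unfolding disjoint_def by blast

text \<open>The two choices cannot collide: different blocks share no edge, and deleted edges lie
  inside \<open>V\<close>, where \<open>E\<close> and \<open>E'\<close> have none.\<close>

lemma absorbs_Un:
  assumes "absorbs A E" "absorbs A' E'" "A \<subseteq> BB" "A' \<subseteq> BB" "A \<inter> A' = {}" "E \<inter> E' = {}"
    and out: "E \<inter> Pow V = {}" "E' \<inter> Pow V = {}"
  shows "absorbs (A \<union> A') (E \<union> E')"
proof -
  obtain e e' where e: "\<forall>B\<in>A. e B \<in> B" "P4dec (e ` A \<union> E)"
    and e': "\<forall>B\<in>A'. e' B \<in> B" "P4dec (e' ` A' \<union> E')"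
    using assms(1,2) unfolding absorbs_def by blast
  have in_V: "e ` A \<subseteq> Pow V" "e' ` A' \<subseteq> Pow V"
    using e(1) e'(1) sub_V assms(3,4) by blast+
  have ee': "e ` A \<inter> e' ` A' = {}"
  proof (rule ccontr)
    assume "e ` A \<inter> e' ` A' \<noteq> {}"
    then obtain B D where "B \<in> A" "D \<in> A'" "e B = e' D" by blast
    then have "e B \<in> B" "e B \<in> D" "B \<in> BB" "D \<in> BB"
      using e(1) e'(1) assms(3,4) by auto
    then have "B = D" by (rule block_unique)
    then show False using \<open>B \<in> A\<close> \<open>D \<in> A'\<close> assms(5) by blast
  qed
  have mixed: "e ` A \<inter> E' = {}" "E \<inter> e' ` A' = {}"
    using in_V out by fast+
  have "P4dec ((e ` A \<union> E) \<union> (e' ` A' \<union> E'))"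
    by (rule P4dec_Un[OF e(2) e'(2)])
       (simp only: Int_Un_distrib Int_Un_distrib2 mixed ee' assms(6) Un_empty simp_thms)
  moreover have "(\<lambda>B. if B \<in> A then e B else e' B) ` (A \<union> A') = e ` A \<union> e' ` A'"
    using assms(5) by force
  ultimately have "P4dec ((\<lambda>B. if B \<in> A then e B else e' B) ` (A \<union> A') \<union> (E \<union> E'))"
    by (simp only: Un_ac)
  moreover have "\<forall>B\<in>A \<union> A'. (if B \<in> A then e B else e' B) \<in> B"
    using e(1) e'(1) by auto
  ultimately show ?thesis unfolding absorbs_def
    by (intro exI[of _ "\<lambda>B. if B \<in> A then e B else e' B"] conjI)
qed

text \<open>Distinct blocks give up distinct edges, and without outer edges these alone fill the
  paths. This fixes the number of heads modulo 3.\<close>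

lemma absorbs_card:
  assumes "absorbs A {}" "A \<subseteq> BB"
  shows "3 dvd card A"
proof -
  obtain e where e: "\<forall>B\<in>A. e B \<in> B" "P4dec (e ` A)"
    using assms(1) unfolding absorbs_def by auto
  have "inj_on e A"
    using block_unique e(1) assms(2) by (intro inj_onI) (metis subsetD)
  then show ?thesis using P4dec_card[OF e(2)] by (simp add: card_image)
qed

definition heads :: "('a set set \<Rightarrow> 'a) \<Rightarrow> 'a set set set \<Rightarrow> bool" where
  "heads h R \<longleftrightarrow> R \<subseteq> BB \<and> inj_on h R \<and> (\<forall>B\<in>R. h B \<in> \<Union>B)"

lemma heads_subset: "heads h R \<Longrightarrow> R' \<subseteq> R \<Longrightarrow> heads h R'"
  unfolding heads_def by (meson inj_on_subset subset_iff)

lemma pendant: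
  assumes "B \<in> BB" "a \<in> \<Union>B"
  obtains p where "p \<noteq> z" "p \<noteq> a" "p \<in> V" "{p, a} \<in> B"
proof -
  obtain p where "p \<noteq> z" "p \<noteq> a" "{p, a} \<in> B"
    using C4_pendant[OF C4[OF assms(1)] assms(2)] by metis
  moreover have "p \<in> V" using sub_V[OF assms(1)] \<open>{p, a} \<in> B\<close> by blast
  ultimately show ?thesis using that by blast
qed

lemma absorbs_edge_between_heads:
  assumes "D \<in> BB" "B1 \<in> BB" "B2 \<in> BB" "D \<noteq> B1" "D \<noteq> B2" "B1 \<noteq> B2"
    and "{a, b} \<in> D" "a \<noteq> b" "a \<in> \<Union>B1" "b \<in> \<Union>B2"
  shows "absorbs {B1, B2, D} {}"
proof -
  obtain p where p: "p \<noteq> a" "{p, a} \<in> B1" using pendant[OF assms(2,9)] by metis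
  \<comment> \<open>The one exclusion available for \<open>q\<close> is spent on \<open>p\<close>.
    The other coincidences, \<open>p = b\<close> and \<open>q = a\<close>, would put the edge
    \<open>{a, b}\<close> of \<open>D\<close> into a second block.\<close>
  obtain q where q: "q \<noteq> p" "q \<noteq> b" "{q, b} \<in> B2" using pendant[OF assms(3,10)] by metis
  have "p \<noteq> b"
    using block_unique[of "{a, b}" D B1] assms(1-4,7) p(2) by (auto simp: insert_commute)
  moreover have "q \<noteq> a"
    using block_unique[of "{a, b}" D B2] assms(1-3,5,7) q(3) by (auto simp: insert_commute)
  ultimately have "distinct [p, a, b, q]" using p q assms(8) by simp
  then have "P4dec ({{p, a}, {a, b}, {b, q}} \<union> {})"
    by (intro P4dec_insert P4dec_empty) simp_all
  moreover define e where "e B = (if B = B1 then {p, a} else if B = B2 then {b, q} else {a, b})" for B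
  moreover have "e ` {B1, B2, D} = {{p, a}, {a, b}, {b, q}}"
    using assms(4-6) unfolding e_def by (simp add: insert_commute)
  moreover have "\<forall>B\<in>{B1, B2, D}. e B \<in> B"
    using p q assms(4-7) unfolding e_def by (simp add: insert_commute)
  ultimately show ?thesis unfolding absorbs_def by (intro exI[of _ e]) simp
qed

text \<open>
  If both ends of an edge of a new block \<open>D\<close> are heads already, then this edge and one edge at
  each end, taken from the two blocks concerned, form a path, and no head is needed for \<open>D\<close>.
\<close>

lemma head_system:
  assumes "A \<subseteq> BB"
  obtains R h where "R \<subseteq> A" "heads h R" "q \<notin> h ` R" "absorbs (A - R) {}"
proof -
  have "finite A" using assms finite_BB by (rule finite_subset)
  then have "\<exists>R h. R \<subseteq> A \<and> heads h R \<and> q \<notin> h ` R \<and> absorbs (A - R) {}"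
    using assms
  proof (induction rule: finite_induct)
    case empty
    show ?case by (intro exI[of _ "{}"]) (simp add: heads_def P4dec_empty)
  next
    case (insert D A)
    then obtain R h where R: "R \<subseteq> A" "heads h R" "q \<notin> h ` R" "absorbs (A - R) {}" by auto
    obtain a b where ab: "a \<noteq> b" "a \<noteq> q" "b \<noteq> q" "{a, b} \<in> D"
      using C4_edge_avoiding[OF C4] insert.prems by (metis insert_subset)
    have D: "D \<in> BB" "D \<notin> A" "D \<notin> R" using insert R(1) by auto
    \<comment> \<open>An end of the edge that is not yet a head becomes the head of
      \<open>D\<close>, and nothing is absorbed.\<close>
    have free: ?case if c: "c \<in> {a, b}" "c \<notin> h ` R" for c
    proof (intro exI[of _ "insert D R"] exI[of _ "h(D := c)"] conjI)
      have "inj_on (h(D := c)) (insert D R)"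
        using R(2) c D(3) unfolding heads_def by (auto simp: inj_on_def)
      moreover have "\<forall>B\<in>insert D R. (h(D := c)) B \<in> \<Union>B"
        using R(2) c(1) ab(4) D(3) unfolding heads_def by auto
      ultimately show "heads (h(D := c)) (insert D R)"
        using R(2) D(1) unfolding heads_def by simp
      have "(h(D := c)) ` insert D R = insert c (h ` R)" using D(3) by auto
      then show "q \<notin> (h(D := c)) ` insert D R" using R(3) c(1) ab by auto
      have "insert D A - insert D R = A - R" using D by blast
      then show "absorbs (insert D A - insert D R) {}" using R(4) by simp
    qed (use R(1) in blast)
    show ?case
    proof (cases "a \<in> h ` R \<and> b \<in> h ` R")
      case True
      then obtain B1 B2 where B: "B1 \<in> R" "B2 \<in> R" "a = h B1" "b = h B2" by blast
      have in_BB: "R \<subseteq> BB" "A \<subseteq> BB" using insert.prems R(1) by auto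
      have B12: "B1 \<noteq> B2" using ab(1) B by blast
      have "absorbs {B1, B2, D} {}"
        using absorbs_edge_between_heads[of D B1 B2 a b] B D B12 ab in_BB R(2)
        unfolding heads_def by blast
      then have "absorbs ((A - R) \<union> {B1, B2, D}) ({} \<union> {})"
        by (intro absorbs_Un R(4)) (use B D R(1) in_BB in auto)
      moreover have "(A - R) \<union> {B1, B2, D} = insert D A - (R - {B1, B2})"
        using B D R(1) by blast
      ultimately have "absorbs (insert D A - (R - {B1, B2})) {}" by simp
      moreover have "heads h (R - {B1, B2})" using heads_subset[OF R(2)] by blast
      ultimately show ?thesis using R(1,3) by (intro exI[of _ "R - {B1, B2}"] exI[of _ h]) auto
    qed (use free in blast)
  qed
  then show ?thesis using that by blast
qed

end

section \<open>Gadgets on two new vertices\<close>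

definition join :: "'a set \<Rightarrow> 'a set \<Rightarrow> 'a set set" where
  "join X S = {{x, a} | x a. x \<in> X \<and> a \<in> S}"

lemma join_empty [simp]: "join {} S = {}" "join X {} = {}"
  by (auto simp: join_def)

lemma join_insert: "join (insert x X) S = (\<lambda>a. {x, a}) ` S \<union> join X S"
  by (auto simp: join_def)

lemma join_Un_left: "join (X \<union> Y) S = join X S \<union> join Y S"
  by (auto simp: join_def)

lemma join_Un_right: "join X (S \<union> T) = join X S \<union> join X T"
  by (auto simp: join_def)

lemma mem_join: "e \<in> join X S \<longleftrightarrow> (\<exists>x\<in>X. \<exists>a\<in>S. e = {x, a})"
  by (auto simp: join_def)

lemma join_disjoint:
  assumes "X \<inter> V = {}" "S \<subseteq> V" "T \<subseteq> V" "S \<inter> T = {}"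
  shows "join X S \<inter> join X T = {}"
proof (rule ccontr)
  assume "join X S \<inter> join X T \<noteq> {}"
  then obtain x a y b where "x \<in> X" "a \<in> S" "y \<in> X" "b \<in> T" "{x, a} = {y, b}"
    unfolding join_def by auto
  then show False using assms by (auto simp: doubleton_eq_iff)
qed

lemma join_outer: "X \<inter> V = {} \<Longrightarrow> join X S \<inter> Pow V = {}"
  unfolding join_def by auto

text \<open>Allows a gadget for \<open>k\<close> elements to be repeated over a set whose size is a
  multiple of \<open>k\<close>.\<close>

lemma chunk_induct:
  assumes "finite S" "k dvd card S" "P {}"
    and step: "\<And>A B. A \<union> B \<subseteq> S \<Longrightarrow> A \<inter> B = {} \<Longrightarrow> card B = k \<Longrightarrow> P A \<Longrightarrow> P (A \<union> B)"
  shows "P S"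
proof -
  obtain n where n: "card S = n * k" using assms(2) by (metis dvdE mult.commute)
  have "T \<subseteq> S \<Longrightarrow> card T = m * k \<Longrightarrow> P T" for T m
  proof (induction m arbitrary: T)
    case 0
    then show ?case using assms(1,3) finite_subset by fastforce
  next
    case (Suc m)
    have "finite T" using Suc.prems(1) assms(1) finite_subset by blast
    obtain B where B: "B \<subseteq> T" "card B = k"
      using obtain_subset_with_card_n[of k T] Suc.prems(2) by auto
    have "card (T - B) = m * k"
      using B Suc.prems(2) \<open>finite T\<close> by (simp add: card_Diff_subset finite_subset)
    then have "P (T - B)" using Suc.IH[of "T - B"] Suc.prems(1) by blast
    then have "P ((T - B) \<union> B)"
      using Suc.prems(1) B by (intro step) auto
    then show ?case using B(1) by (simp add: Un_absorb2)
  qed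
  then show ?thesis using n by blast
qed

lemma P4dec_K23:
  assumes "distinct [x, y, a, b, c]"
  shows "P4dec (join {x, y} {a, b, c})"
proof (rule P4dec_pathsI[of "[(x, a, y, b), (b, x, c, y)]"])
  show "set (concat (map path_edges [(x, a, y, b), (b, x, c, y)])) = join {x, y} {a, b, c}"
    by (simp add: join_insert insert_commute)
qed (use assms in \<open>auto simp: doubleton_eq_iff\<close>)

lemma P4dec_K114:
  assumes "distinct [x, y, a, b, c, d]"
  shows "P4dec (insert {x, y} (join {x, y} {a, b, c, d}))"
proof (rule P4dec_pathsI[of "[(a, x, y, b), (b, x, c, y), (x, d, y, a)]"])
  show "set (concat (map path_edges [(a, x, y, b), (b, x, c, y), (x, d, y, a)])) =
      insert {x, y} (join {x, y} {a, b, c, d})"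
    by (simp add: join_insert insert_commute)
qed (use assms in \<open>auto simp: doubleton_eq_iff\<close>)

text \<open>
  In \<open>P4dec_heads_i_j\<close> the old vertices are \<open>i\<close> heads, with pendant edges to \<open>p\<close> and \<open>q\<close>, and \<open>j\<close>
  further vertices. The pendant ends may coincide with old vertices that are not excluded.
\<close>

lemma P4dec_heads_2_0:
  assumes "distinct [x, y, a, b]" "p \<notin> {x, y, a, b}" "q \<notin> {x, y, a, b}"
  shows "P4dec (insert {p, a} (insert {q, b} (join {x, y} {a, b})))"
proof (rule P4dec_pathsI[of "[(p, a, x, b), (q, b, y, a)]"])
  show "set (concat (map path_edges [(p, a, x, b), (q, b, y, a)])) =
      insert {p, a} (insert {q, b} (join {x, y} {a, b}))"
    by (simp add: join_insert insert_commute)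
qed (use assms in \<open>auto simp: doubleton_eq_iff\<close>)

lemma P4dec_heads_1_3:
  assumes "distinct [x, y, a, b, c, d]" "p \<notin> {x, y, a, b}"
  shows "P4dec (insert {p, a} (join {x, y} {a, b, c, d}))"
proof (rule P4dec_pathsI[of "[(p, a, x, b), (a, y, c, x), (b, y, d, x)]"])
  show "set (concat (map path_edges [(p, a, x, b), (a, y, c, x), (b, y, d, x)])) =
      insert {p, a} (join {x, y} {a, b, c, d})"
    by (simp add: join_insert insert_commute)
qed (use assms in \<open>auto simp: doubleton_eq_iff\<close>)

lemma P4dec_heads_2_1:
  assumes "distinct [x, y, a, b, d]" "p \<notin> {x, y, a, d}" "q \<notin> {x, y, b, d}" "{p, a} \<noteq> {q, b}"
  shows "P4dec (insert {p, a} (insert {q, b} (insert {x, y} (join {x, y} {a, b, d}))))"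
proof (rule P4dec_pathsI[of "[(p, a, x, d), (q, b, y, d), (b, x, y, a)]"])
  show "set (concat (map path_edges [(p, a, x, d), (q, b, y, d), (b, x, y, a)])) =
      insert {p, a} (insert {q, b} (insert {x, y} (join {x, y} {a, b, d})))"
    by (simp add: join_insert insert_commute)
qed (use assms in \<open>auto simp: doubleton_eq_iff\<close>)

lemma P4dec_heads_1_4:
  assumes "distinct [x, y, a, b, c, d, e]" "p \<notin> {x, y, a, b}"
  shows "P4dec (insert {p, a} (insert {x, y} (join {x, y} {a, b, c, d, e})))"
proof (rule P4dec_pathsI[of "[(p, a, x, b), (a, y, x, c), (b, y, d, x), (c, y, e, x)]"])
  show "set (concat (map path_edges [(p, a, x, b), (a, y, x, c), (b, y, d, x), (c, y, e, x)])) =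
      insert {p, a} (insert {x, y} (join {x, y} {a, b, c, d, e}))"
    by (simp add: join_insert insert_commute)
qed (use assms in \<open>auto simp: doubleton_eq_iff\<close>)

lemma absorbs_single: "e \<in> B \<Longrightarrow> P4dec (insert e E) \<Longrightarrow> absorbs {B} E"
  unfolding absorbs_def by (intro exI[of _ "\<lambda>_. e"]) simp

lemma absorbs_pair:
  assumes "e \<in> B" "f \<in> D" "B \<noteq> D" "P4dec (insert e (insert f E))"
  shows "absorbs {B, D} E"
  unfolding absorbs_def using assms
  by (intro exI[of _ "\<lambda>X. if X = B then e else f"]) (simp add: insert_commute)

lemma P4dec_join2:
  assumes "finite S" "3 dvd card S" "x \<noteq> y" "x \<notin> S" "y \<notin> S"
  shows "P4dec (join {x, y} S)"
proof (rule chunk_induct[OF assms(1,2)])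
  fix A B assume *: "A \<union> B \<subseteq> S" "A \<inter> B = {}" "card B = 3" "P4dec (join {x, y} A)"
  obtain a b c where B: "B = {a, b, c}" "distinct [a, b, c]"
    using *(3) by (metis card_3_iff distinct_length_2_or_more distinct_singleton)
  have "P4dec (join {x, y} B)"
    unfolding B(1) by (rule P4dec_K23) (use * B assms in auto)
  then have "P4dec (join {x, y} A \<union> join {x, y} B)"
    by (intro P4dec_Un *(4) join_disjoint[of _ S]) (use * assms in auto)
  then show "P4dec (join {x, y} (A \<union> B))" by (simp only: join_Un_right)
qed (simp add: P4dec_empty)

section \<open>Absorbing blocks with heads by two new vertices\<close>

locale c4_family_two = c4_family +
  fixes x y
  assumes xy: "x \<noteq> y" "x \<notin> V" "y \<notin> V"
begin

lemma join_out: "join {x, y} S \<inter> Pow V = {}"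
  using xy by (intro join_outer) auto

lemma edge_out: "S \<subseteq> V \<Longrightarrow> {x, y} \<notin> join {x, y} S" "{x, y} \<notin> Pow V"
  using xy by (auto simp: join_def doubleton_eq_iff)

lemma head_in_V: "heads h R \<Longrightarrow> B \<in> R \<Longrightarrow> h B \<in> V"
  unfolding heads_def using sub_V by blast

lemma finite_heads: "heads h R \<Longrightarrow> finite R"
  unfolding heads_def using finite_BB finite_subset by blast

lemma card_heads: "heads h R \<Longrightarrow> card (h ` R) = card R"
  unfolding heads_def by (simp add: card_image)

lemma head_pendant:
  assumes "heads h R" "B \<in> R"
  obtains p where "p \<noteq> z" "p \<noteq> h B" "p \<in> V" "{p, h B} \<in> B"
  using pendant[of B "h B" z] assms unfolding heads_def by blast

lemma heads_neq:
  assumes "heads h R" "B \<in> R" "D \<in> R" "B \<noteq> D"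
  shows "h B \<noteq> h D"
  using assms unfolding heads_def inj_on_def by blast

lemma absorbs_heads_2_0:
  assumes R: "heads h R" "B \<in> R" "D \<in> R" "B \<noteq> D"
  shows "absorbs {B, D} (join {x, y} {h B, h D})"
proof -
  obtain p where p: "p \<noteq> h D" "p \<noteq> h B" "p \<in> V" "{p, h B} \<in> B"
    using head_pendant[OF R(1,2)] .
  obtain q where q: "q \<noteq> h B" "q \<noteq> h D" "q \<in> V" "{q, h D} \<in> D"
    using head_pendant[OF R(1,3)] .
  show ?thesis
    by (rule absorbs_pair[OF p(4) q(4) R(4)], rule P4dec_heads_2_0)
       (use p q xy heads_neq[OF R] head_in_V[OF R(1)] R in auto)
qed

lemma absorbs_heads_2_1:
  assumes R: "heads h R" "B \<in> R" "D \<in> R" "B \<noteq> D"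
    and d: "d \<in> V" "d \<noteq> h B" "d \<noteq> h D"
  shows "absorbs {B, D} (insert {x, y} (join {x, y} {h B, h D, d}))"
proof -
  obtain p where p: "p \<noteq> d" "p \<noteq> h B" "p \<in> V" "{p, h B} \<in> B"
    using head_pendant[OF R(1,2)] .
  obtain q where q: "q \<noteq> d" "q \<noteq> h D" "q \<in> V" "{q, h D} \<in> D"
    using head_pendant[OF R(1,3)] .
  \<comment> \<open>Both exclusions went to \<open>d\<close>, so \<open>p = h D\<close> or
    \<open>q = h B\<close> may occur. They cannot both occur, as the two pendant edges would then be
    one edge in two blocks.\<close>
  have "{p, h B} \<noteq> {q, h D}"
    using block_unique[OF p(4), of D] q(4) R unfolding heads_def by (metis subsetD)
  then show ?thesis
    by (intro absorbs_pair[OF p(4) q(4) R(4)] P4dec_heads_2_1)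
       (use p q xy d heads_neq[OF R] head_in_V[OF R(1)] R in auto)
qed

lemma absorbs_heads_1_3:
  assumes R: "heads h R" "B \<in> R" and d: "{b, c, d} \<subseteq> V" "distinct [h B, b, c, d]"
  shows "absorbs {B} (join {x, y} {h B, b, c, d})"
proof -
  obtain p where p: "p \<noteq> b" "p \<noteq> h B" "p \<in> V" "{p, h B} \<in> B"
    using head_pendant[OF R] .
  show ?thesis
    by (rule absorbs_single[OF p(4)], rule P4dec_heads_1_3)
       (use p xy d head_in_V[OF R] in auto)
qed

lemma absorbs_heads_1_4:
  assumes R: "heads h R" "B \<in> R" and d: "{b, c, d, e} \<subseteq> V" "distinct [h B, b, c, d, e]"
  shows "absorbs {B} (insert {x, y} (join {x, y} {h B, b, c, d, e}))"
proof -
  obtain p where p: "p \<noteq> b" "p \<noteq> h B" "p \<in> V" "{p, h B} \<in> B"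
    using head_pendant[OF R] .
  show ?thesis
    by (rule absorbs_single[OF p(4)], rule P4dec_heads_1_4)
       (use p xy d head_in_V[OF R] in auto)
qed

lemma absorbs_heads_even:
  assumes R: "heads h R" and "even (card R)"
  shows "absorbs R (join {x, y} (h ` R))"
proof (rule chunk_induct[OF finite_heads[OF R], of 2])
  show "absorbs {} (join {x, y} (h ` {}))" by (simp add: P4dec_empty)
  fix A G assume *: "A \<union> G \<subseteq> R" "A \<inter> G = {}" "card G = 2" "absorbs A (join {x, y} (h ` A))"
  obtain B D where G: "G = {B, D}" "B \<noteq> D" using *(3) by (meson card_2_iff)
  have "absorbs G (join {x, y} (h ` G))"
    unfolding G using absorbs_heads_2_0[OF R] G *(1) by simp
  moreover have "h ` A \<inter> h ` G = {}" 
    using R *(1,2) unfolding heads_def by (metis Int_Un_eq(1) Un_subset_iff image_empty inj_on_image_Int)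
  moreover have "h ` A \<subseteq> V" "h ` G \<subseteq> V" using head_in_V[OF R] *(1) by auto
  moreover have "A \<subseteq> BB" "G \<subseteq> BB" using R *(1) unfolding heads_def by auto
  ultimately have "absorbs (A \<union> G) (join {x, y} (h ` A) \<union> join {x, y} (h ` G))"
    using *(2,4) xy by (intro absorbs_Un join_out join_disjoint[of _ V]) auto
  then show "absorbs (A \<union> G) (join {x, y} (h ` (A \<union> G)))"
    by (simp only: join_Un_right image_Un)
qed (use assms(2) in simp)

lemma absorbs_join_even:
  assumes R: "heads h R" "even (card R)" and S: "h ` R \<subseteq> S" "S \<subseteq> V" "3 dvd card (S - h ` R)"
  shows "absorbs R (join {x, y} S)"
proof -
  have "finite S" using S(2) finite_V finite_subset by blast
  have "absorbs (R \<union> {}) (join {x, y} (h ` R) \<union> join {x, y} (S - h ` R))"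
  proof (rule absorbs_Un[OF absorbs_heads_even[OF R]])
    show "absorbs {} (join {x, y} (S - h ` R))"
      unfolding absorbs_empty by (rule P4dec_join2) (use S xy \<open>finite S\<close> in auto)
    show "join {x, y} (h ` R) \<inter> join {x, y} (S - h ` R) = {}"
      using xy S by (intro join_disjoint[of _ V]) auto
  qed (use R in \<open>auto simp: heads_def join_out\<close>)
  moreover have "h ` R \<union> (S - h ` R) = S" using S(1) by blast
  ultimately show ?thesis by (simp flip: join_Un_right)
qed

text \<open>One exceptional gadget on \<open>T\<close> settles what the regular scheme cannot: an
  odd number of heads, or the edge \<open>{x, y}\<close> in \<open>F\<close>. What remains splits
  into pairs of heads and triples of other vertices.\<close>

lemma absorbs_join_from_part:
  assumes R: "heads h R" and S: "h ` R \<subseteq> S" "S \<subseteq> V"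
    and G: "G \<subseteq> R" "T \<subseteq> S" "T \<inter> h ` R = h ` G" "F \<subseteq> {{x, y}}" "absorbs G (F \<union> join {x, y} T)"
    and "even (card (R - G))" and dvd: "3 dvd card (S - T - h ` R)"
  shows "absorbs R (F \<union> join {x, y} S)"
proof -
  have "inj_on h R" using R unfolding heads_def by blast
  then have im: "h ` (R - G) = h ` R - h ` G" by (rule inj_on_image_set_diff) (use G(1) in blast)+
  have RG: "heads h (R - G)" using heads_subset[OF R] by blast
  have "absorbs (R - G) (join {x, y} (S - T))"
  proof (rule absorbs_join_even[OF RG assms(9)])
    show "h ` (R - G) \<subseteq> S - T" using im S(1) G(3) by blast
    have "S - T - h ` (R - G) = S - T - h ` R" using im G(3) by blast
    then show "3 dvd card (S - T - h ` (R - G))" using dvd by simp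
  qed (use S(2) in blast)
  then have "absorbs (G \<union> (R - G)) ((F \<union> join {x, y} T) \<union> join {x, y} (S - T))"
  proof (rule absorbs_Un[OF G(5)])
    have "join {x, y} T \<inter> join {x, y} (S - T) = {}"
      using xy S(2) G(2) by (intro join_disjoint[of _ V]) auto
    then show "(F \<union> join {x, y} T) \<inter> join {x, y} (S - T) = {}"
      using G(4) edge_out(1)[of "S - T"] S(2) by blast
    show "(F \<union> join {x, y} T) \<inter> Pow V = {}"
      using G(4) edge_out(2) join_out by blast
  qed (use R G(1) in \<open>auto simp: heads_def join_out\<close>)
  moreover have "G \<union> (R - G) = R" "T \<union> (S - T) = S" using G(1,2) by blast+
  ultimately show ?thesis by (simp add: Un_assoc flip: join_Un_right)
qed

text \<open>An odd head is combined with three vertices that are not heads. They exist because the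
  number of such vertices is a multiple of 3 and, by \<open>ne\<close>, positive.\<close>

lemma absorbs_join:
  assumes R: "heads h R" and S: "h ` R \<subseteq> S" "S \<subseteq> V" "3 dvd card (S - h ` R)"
    and ne: "even (card R) \<or> S \<noteq> h ` R"
  shows "absorbs R (join {x, y} S)"
proof (cases "even (card R)")
  case True
  then show ?thesis using absorbs_join_even R S by blast
next
  case False
  have fin: "finite R" "finite S" using finite_heads[OF R] S(2) finite_V finite_subset by blast+
  obtain B where B: "B \<in> R" using False by fastforce
  have "S - h ` R \<noteq> {}" using ne False S(1) by blast
  then have "card (S - h ` R) \<noteq> 0" using fin by simp
  then have "3 \<le> card (S - h ` R)" using S(3) by (simp add: dvd_imp_le)
  then obtain N where N: "N \<subseteq> S - h ` R" "card N = 3" by (meson obtain_subset_with_card_n)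
  then obtain b c d where bcd: "N = {b, c, d}" "distinct [b, c, d]"
    by (metis card_3_iff distinct_length_2_or_more distinct_singleton)
  have "absorbs {B} ({} \<union> join {x, y} (insert (h B) N))"
    unfolding bcd(1) Un_empty_left
    by (rule absorbs_heads_1_3[OF R B]) (use N bcd B S(2) in auto)
  moreover have "card (S - insert (h B) N - h ` R) = card (S - h ` R) - 3"
  proof -
    have "S - insert (h B) N - h ` R = (S - h ` R) - N" using B by blast
    then show ?thesis using N fin by (simp add: card_Diff_subset finite_subset)
  qed
  moreover have "card (R - {B}) = card R - 1" using B fin by simp
  note * = calculation
  have "absorbs R ({} \<union> join {x, y} S)"
    by (rule absorbs_join_from_part[OF R, of S "{B}" "insert (h B) N" "{}"]) (use * N B S False in auto)
  then show ?thesis by simp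
qed

text \<open>If only one vertex is not a head, oddness of \<open>card S\<close> makes
  \<open>card R\<close> even and positive, so two heads can join it in the gadget that takes
  \<open>{x, y}\<close>. Otherwise there are at least four such vertices, and the gadget uses four
  of them with no head or one head, whichever leaves an even number of heads.\<close>

lemma absorbs_join_edge:
  assumes R: "heads h R" and S: "h ` R \<subseteq> S" "S \<subseteq> V" "card (S - h ` R) mod 3 = 1"
    and odd: "odd (card S)" "card S > 1"
  shows "absorbs R (insert {x, y} (join {x, y} S))"
proof -
  let ?N = "S - h ` R"
  have fin: "finite R" "finite S" "finite ?N"
    using finite_heads[OF R] S(2) finite_V finite_subset by blast+
  have card: "card S = card R + card ?N"
    using card_heads[OF R] S(1) fin card_Diff_subset[of "h ` R" S] card_mono[of S "h ` R"] by simp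
  have "absorbs R ({{x, y}} \<union> join {x, y} S)"
  proof (cases "card ?N = 1")
    case True
    then obtain d where d: "?N = {d}" by (rule card_1_singletonE)
    have "2 \<le> card R" using card True odd by presburger
    then obtain G where G: "G \<subseteq> R" "card G = 2" by (meson obtain_subset_with_card_n)
    then obtain B D where BD: "G = {B, D}" "B \<noteq> D" by (meson card_2_iff)
    have hd: "h B \<noteq> d" "h D \<noteq> d" "d \<notin> h ` R" "d \<in> S" "h B \<in> S" "h D \<in> S" using G BD d S(1) by auto
    have card_G: "card (R - G) = card R - 2" using G fin by (simp add: card_Diff_subset finite_subset)
    show ?thesis
    proof (rule absorbs_join_from_part[OF R S(1,2) G(1)])
      show "absorbs G ({{x, y}} \<union> join {x, y} {h B, h D, d})"
        unfolding BD(1) insert_is_Un[symmetric]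
        by (rule absorbs_heads_2_1[OF R]) (use G BD hd S(2) in auto)
      have "{h B, h D} = h ` G" using BD by simp
      then show "{h B, h D, d} \<inter> h ` R = h ` G" "{h B, h D, d} \<subseteq> S"
        using G(1) hd S(1) by auto
      show "even (card (R - G))" using card_G card True odd by simp
      have "S - {h B, h D, d} - h ` R = {}" using d by blast
      then show "3 dvd card (S - {h B, h D, d} - h ` R)" by (simp only: card.empty dvd_0_right)
    qed simp
  next
    case False
    then have "4 \<le> card ?N" using S(3) by presburger
    then obtain N where N: "N \<subseteq> ?N" "card N = 4" by (meson obtain_subset_with_card_n)
    then obtain b N' where "N = insert b N'" "b \<notin> N'" "card N' = 3"
      using card_Suc_eq[of N 3] by auto
    then obtain b c d e where N4: "N = {b, c, d, e}" "distinct [b, c, d, e]"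
      by (metis card_3_iff distinct_length_2_or_more distinct_singleton insert_iff empty_iff)
    have rest: "3 dvd card (?N - N)"
      using N fin S(3) by (simp add: card_Diff_subset finite_subset) presburger
    show ?thesis
    proof (cases "even (card R)")
      case True
      have N_eq: "S - N - h ` R = ?N - N" by blast
      show ?thesis
      proof (rule absorbs_join_from_part[OF R S(1,2)])
        show "absorbs {} ({{x, y}} \<union> join {x, y} N)"
          unfolding N4(1) insert_is_Un[symmetric] absorbs_empty
          by (rule P4dec_K114) (use N N4 S(2) xy in auto)
        show "3 dvd card (S - N - h ` R)" using rest N_eq by simp
      qed (use N True in auto)
    next
      case False
      then obtain B where B: "B \<in> R" by fastforce
      have N_eq: "S - insert (h B) N - h ` R = ?N - N" using B by blast
      have card_B: "card (R - {B}) = card R - 1" using B fin by simp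
      show ?thesis
      proof (rule absorbs_join_from_part[OF R S(1,2)])
        show "absorbs {B} ({{x, y}} \<union> join {x, y} (insert (h B) N))"
          unfolding N4(1) insert_is_Un[symmetric]
          by (rule absorbs_heads_1_4[OF R B]) (use N N4 B S(2) in auto)
        show "3 dvd card (S - insert (h B) N - h ` R)" using rest N_eq by simp
        show "even (card (R - {B}))" using False card_B by simp
      qed (use N B S(1) in auto)
    qed
  qed
  then show ?thesis by simp
qed

end

section \<open>Adding new vertices to a complete graph\<close>

definition clique :: "'a set \<Rightarrow> 'a set set" where
  "clique V = {e. e \<subseteq> V \<and> card e = 2}"

lemma mem_clique: "e \<in> clique V \<longleftrightarrow> (\<exists>a\<in>V. \<exists>b\<in>V. a \<noteq> b \<and> e = {a, b})"
  unfolding clique_def by (auto simp: card_2_iff)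

lemma card_clique: "finite V \<Longrightarrow> card (clique V) = card V choose 2"
  unfolding clique_def by (rule n_subsets)

lemma clique_empty [simp]: "clique {} = {}"
  by (auto simp: clique_def)

lemma clique_Un:
  assumes "A \<inter> B = {}"
  shows "clique (A \<union> B) = clique A \<union> clique B \<union> join A B"
proof (intro equalityI subsetI)
  fix e assume "e \<in> clique (A \<union> B)"
  then obtain a b where ab: "a \<in> A \<union> B" "b \<in> A \<union> B" "a \<noteq> b" "e = {a, b}"
    unfolding mem_clique by blast
  then consider "a \<in> A" "b \<in> A" | "a \<in> B" "b \<in> B" | "a \<in> A" "b \<in> B" | "b \<in> A" "a \<in> B"
    by blast
  then have "e \<in> clique A \<or> e \<in> clique B \<or> e \<in> join A B"
  proof cases
    case 1 then show ?thesis using ab(3,4) mem_clique by blast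
  next
    case 2 then show ?thesis using ab(3,4) mem_clique by blast
  next
    case 3 then show ?thesis using ab(4) mem_join by blast
  next
    case 4
    have "e = {b, a}" using ab(4) by (simp add: insert_commute)
    then show ?thesis using 4 mem_join by blast
  qed
  then show "e \<in> clique A \<union> clique B \<union> join A B" by blast
next
  fix e assume "e \<in> clique A \<union> clique B \<union> join A B"
  then consider "e \<in> clique A \<union> clique B" | "e \<in> join A B" by blast
  then show "e \<in> clique (A \<union> B)"
  proof cases
    case 1 then show ?thesis by (auto simp: clique_def)
  next
    case 2
    then obtain a b where "a \<in> A" "b \<in> B" "e = {a, b}" unfolding mem_join by blast
    moreover have "a \<noteq> b" using assms calculation(1,2) by blast
    ultimately show ?thesis unfolding mem_clique by blast
  qed
qed

lemma clique_insert: "x \<notin> X \<Longrightarrow> clique (insert x X) = clique X \<union> (\<lambda>a. {x, a}) ` X"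
  using clique_Un[of X "{x}"] clique_Un[of "{}" "{x}"]
  by (auto simp: join_insert join_def mem_clique insert_commute)

lemma clique_2: "x \<noteq> y \<Longrightarrow> clique {x, y} = {{x, y}}"
  by (simp add: clique_insert)

lemma clique_3: "distinct [x, y, z] \<Longrightarrow> clique {x, y, z} = {{x, y}, {x, z}, {y, z}}"
  by (simp add: clique_insert insert_commute[of "{y, z}"])

lemma clique_4:
  "distinct [x, y, z, t] \<Longrightarrow> clique {x, y, z, t} = {{x, y}, {x, z}, {x, t}, {y, z}, {y, t}, {z, t}}"
  using clique_3[of y z t] by (simp add: clique_insert[of x])

lemma clique_join_disjoint: "A \<inter> B = {} \<Longrightarrow> clique A \<inter> join A B = {}"
  by (auto simp: mem_clique mem_join doubleton_eq_iff) blast+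

lemma P4dec_K4:
  assumes "distinct [x, y, z, t]"
  shows "P4dec (clique {x, y, z, t})"
proof (rule P4dec_pathsI[of "[(x, y, z, t), (y, t, x, z)]"])
  show "set (concat (map path_edges [(x, y, z, t), (y, t, x, z)])) = clique {x, y, z, t}"
    unfolding clique_4[OF assms] by (simp add: insert_commute)
qed (use assms in \<open>auto simp: doubleton_eq_iff\<close>)

lemma P4dec_K33:
  assumes "distinct [x, y, z, a, b, c]"
  shows "P4dec (join {x, y, z} {a, b, c})"
proof (rule P4dec_pathsI[of "[(x, a, y, b), (y, c, z, a), (z, b, x, c)]"])
  show "set (concat (map path_edges [(x, a, y, b), (y, c, z, a), (z, b, x, c)])) =
      join {x, y, z} {a, b, c}"
    by (simp add: join_insert insert_commute)
qed (use assms in \<open>auto simp: doubleton_eq_iff\<close>)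

lemma P4dec_K3_K33:
  assumes "distinct [x, y, z, a, b, c]"
  shows "P4dec (clique {x, y, z} \<union> join {x, y, z} {a, b, c})"
proof (rule P4dec_pathsI[of "[(a, x, y, b), (b, x, z, c), (x, c, y, z), (y, a, z, b)]"])
  have "distinct [x, y, z]" using assms by simp
  then show "set (concat (map path_edges [(a, x, y, b), (b, x, z, c), (x, c, y, z), (y, a, z, b)])) =
      clique {x, y, z} \<union> join {x, y, z} {a, b, c}"
    by (simp only: clique_3) (simp add: join_insert insert_commute)
qed (use assms in \<open>auto simp: doubleton_eq_iff\<close>)

lemma P4dec_join3:
  assumes "finite S" "3 dvd card S" "distinct [x, y, z]" "{x, y, z} \<inter> S = {}"
  shows "P4dec (join {x, y, z} S)"
proof (rule chunk_induct[OF assms(1,2)])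
  fix A B assume *: "A \<union> B \<subseteq> S" "A \<inter> B = {}" "card B = 3" "P4dec (join {x, y, z} A)"
  obtain a b c where B: "B = {a, b, c}" "distinct [a, b, c]"
    using *(3) by (metis card_3_iff distinct_length_2_or_more distinct_singleton)
  have "P4dec (join {x, y, z} B)"
    unfolding B(1) by (rule P4dec_K33) (use * B assms in auto)
  then have "P4dec (join {x, y, z} A \<union> join {x, y, z} B)"
    by (intro P4dec_Un *(4) join_disjoint[of _ S]) (use * assms in auto)
  then show "P4dec (join {x, y, z} (A \<union> B))" by (simp only: join_Un_right)
qed (simp add: P4dec_empty)

text \<open>With m = \<open>card W\<close> there are 1 + 2m edges, which forces m to be 1 modulo 3;
  for m = 1 they form a triangle. For larger m one copy of K_{1,1,4} takes \<open>{x, y}\<close>,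
  and copies of K_{2,3} exhaust the rest.\<close>

lemma P4dec_two_new_vertices:
  assumes "finite W" "card W mod 3 = 1" "card W > 1" "distinct [x, y]" "{x, y} \<inter> W = {}"
  shows "P4dec (clique {x, y} \<union> join {x, y} W)"
proof -
  have "4 \<le> card W" using assms(2,3) by presburger
  then obtain T where T: "T \<subseteq> W" "card T = 4" by (meson obtain_subset_with_card_n)
  then obtain a T' where "T = insert a T'" "a \<notin> T'" "card T' = 3"
    using card_Suc_eq[of T 3] by auto
  then obtain b c d where T4: "T = {a, b, c, d}" "distinct [a, b, c, d]"
    by (metis card_3_iff distinct_length_2_or_more distinct_singleton insert_iff empty_iff)
  have "P4dec (insert {x, y} (join {x, y} T))"
    unfolding T4(1) by (rule P4dec_K114) (use T T4 assms in auto)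
  moreover have "card (W - T) = card W - 4"
    using T assms(1) by (simp add: card_Diff_subset finite_subset)
  then have "3 dvd card (W - T)" using assms(2) \<open>4 \<le> card W\<close> by presburger
  then have "P4dec (join {x, y} (W - T))"
    by (rule P4dec_join2[rotated]) (use assms in auto)
  moreover have "join {x, y} T \<inter> join {x, y} (W - T) = {}"
    using T assms by (intro join_disjoint[of _ W]) auto
  moreover have "{x, y} \<notin> join {x, y} (W - T)"
    using assms(5) by (auto simp: mem_join doubleton_eq_iff)
  ultimately have "P4dec (insert {x, y} (join {x, y} T) \<union> join {x, y} (W - T))"
    by (intro P4dec_Un) auto
  moreover have "T \<union> (W - T) = W" using T(1) by blast
  then have "insert {x, y} (join {x, y} T) \<union> join {x, y} (W - T) = clique {x, y} \<union> join {x, y} W"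
    using assms(4) by (simp add: clique_2 flip: join_Un_right)
  ultimately show ?thesis by simp
qed

text \<open>The number 3 + 3m of edges is always a multiple of 3. The new triangle needs help from
  old vertices: one of them completes it to K_4, and three of them serve in the other residue class.
  Copies of K_{3,3} exhaust the rest.\<close>

lemma P4dec_three_new_vertices:
  assumes W: "finite W" "card W mod 3 = 0 \<or> card W mod 3 = 1" "W \<noteq> {}"
    and xyz: "distinct [x, y, z]" "{x, y, z} \<inter> W = {}"
  shows "P4dec (clique {x, y, z} \<union> join {x, y, z} W)"
proof -
  have "\<exists>T \<subseteq> W. card T mod 3 = card W mod 3 \<and> P4dec (clique {x, y, z} \<union> join {x, y, z} T)"
  proof (cases "card W mod 3 = 0")
    case True
    have "card W \<noteq> 0" using W by simp
    then have "3 \<le> card W" using True by presburger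
    then obtain T where T: "T \<subseteq> W" "card T = 3" by (meson obtain_subset_with_card_n)
    then obtain a b c where abc: "T = {a, b, c}" "distinct [a, b, c]"
      by (metis card_3_iff distinct_length_2_or_more distinct_singleton)
    have "P4dec (clique {x, y, z} \<union> join {x, y, z} T)"
      unfolding abc(1) by (rule P4dec_K3_K33) (use T abc xyz in auto)
    then show ?thesis using T True by (intro exI[of _ T]) simp
  next
    case False
    obtain q where q: "q \<in> W" using W by blast
    have "P4dec (clique {x, y, z, q})"
      by (rule P4dec_K4) (use q xyz in auto)
    also have "clique {x, y, z, q} = clique {x, y, z} \<union> join {x, y, z} {q}"
    proof -
      have "{x, y, z} \<inter> {q} = {}" "{x, y, z} \<union> {q} = {x, y, z, q}" using q xyz(2) by auto
      moreover have "clique {q} = {}" by (simp add: clique_insert[of q "{}", simplified])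
      ultimately show ?thesis using clique_Un[of "{x, y, z}" "{q}"] by (simp only: Un_empty_right)
    qed
    finally show ?thesis using q False W(2) by (intro exI[of _ "{q}"]) auto
  qed
  then obtain T where T: "T \<subseteq> W" "card T mod 3 = card W mod 3"
    "P4dec (clique {x, y, z} \<union> join {x, y, z} T)" by blast
  have "card W = card T + card (W - T)"
    using T(1) W(1) by (simp add: card_Diff_subset card_mono finite_subset)
  then have dvd: "3 dvd card (W - T)"
    using T(2) by (metis add_diff_cancel_left' le_add1 mod_eq_dvd_iff_nat)
  have "P4dec (join {x, y, z} (W - T))"
    by (rule P4dec_join3) (use dvd W xyz in auto)
  moreover have "join {x, y, z} T \<inter> join {x, y, z} (W - T) = {}"
    using T xyz by (intro join_disjoint[of _ W]) auto
  moreover have "clique {x, y, z} \<inter> join {x, y, z} (W - T) = {}"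
    using xyz by (intro clique_join_disjoint) auto
  ultimately have "P4dec ((clique {x, y, z} \<union> join {x, y, z} T) \<union> join {x, y, z} (W - T))"
    by (intro P4dec_Un T(3)) (simp_all add: Int_Un_distrib2)
  moreover have "T \<union> (W - T) = W" using T(1) by blast
  ultimately show ?thesis by (simp only: Un_assoc flip: join_Un_right)
qed

section \<open>Arbitrary 4-cycle designs\<close>

locale c4_design = c4_family +
  assumes cover: "\<Union>BB = clique V" and card_V: "card V > 1"
begin

definition blocks_at :: "'a \<Rightarrow> 'a set set set" where
  "blocks_at q = {B \<in> BB. q \<in> \<Union>B}"

lemma blocks_at_subset: "blocks_at q \<subseteq> BB" "finite (blocks_at q)"
  using finite_BB by (auto simp: blocks_at_def)

text \<open>Each block through \<open>q\<close> contains exactly two of the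
  \<open>card V - 1\<close> edges at \<open>q\<close>.\<close>

lemma card_blocks_at:
  assumes "q \<in> V"
  shows "2 * card (blocks_at q) = card V - 1"
proof -
  have inj: "inj_on (\<lambda>a. {q, a}) (V - {q})"
    by (auto simp: inj_on_def doubleton_eq_iff)
  have "(\<lambda>a. {q, a}) ` (V - {q}) = {e \<in> \<Union>BB. q \<in> e}"
    using assms unfolding cover mem_clique by auto
  also have "\<dots> = (\<Union>B\<in>blocks_at q. {e \<in> B. q \<in> e})"
    unfolding blocks_at_def by auto
  also have "card \<dots> = (\<Sum>B\<in>blocks_at q. card {e \<in> B. q \<in> e})"
  proof (rule card_UN_disjoint)
    show "\<forall>B\<in>blocks_at q. finite {e \<in> B. q \<in> e}"
      using C4_minus_edge(2)[OF C4] unfolding blocks_at_def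
      by (metis (no_types, lifting) UnionE card.infinite finite_subset mem_Collect_eq subsetI zero_neq_numeral)
    show "\<forall>B\<in>blocks_at q. \<forall>D\<in>blocks_at q. B \<noteq> D \<longrightarrow> {e \<in> B. q \<in> e} \<inter> {e \<in> D. q \<in> e} = {}"
      using block_unique blocks_at_subset(1) by blast
  qed (rule blocks_at_subset)
  also have "\<dots> = (\<Sum>B\<in>blocks_at q. 2)"
  proof (rule sum.cong[OF refl])
    fix B assume B: "B \<in> blocks_at q"
    then obtain a b where "a \<noteq> b" "a \<noteq> q" "b \<noteq> q" "{e \<in> B. q \<in> e} = {{q, a}, {q, b}}"
      using C4_two_neighbours[OF C4] unfolding blocks_at_def by (metis (lifting) mem_Collect_eq)
    moreover have "{q, a} \<noteq> {q, b}" using calculation by (simp add: doubleton_eq_iff)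
    ultimately show "card {e \<in> B. q \<in> e} = 2" by simp
  qed
  finally have "card (V - {q}) = 2 * card (blocks_at q)" by (simp add: card_image[OF inj])
  then show ?thesis using assms finite_V by simp
qed

lemma card_blocks: "8 * card BB = card V * (card V - 1)"
proof -
  have "card (\<Union>BB) = (\<Sum>B\<in>BB. card B)"
  proof (rule card_Union_disjoint)
    show "pairwise disjnt BB" using disj by (simp add: disjoint_def pairwise_def disjnt_def)
    show "finite B" if "B \<in> BB" for B
      using C4_minus_edge(2)[OF C4[OF that]] C4[OF that] unfolding is_C4_def by auto
  qed
  also have "\<dots> = (\<Sum>B\<in>BB. 4)"
  proof (rule sum.cong[OF refl])
    fix B assume "B \<in> BB"
    then obtain e where "e \<in> B" using C4 unfolding is_C4_def by blast
    then show "card B = 4" using C4_minus_edge(2)[OF C4[OF \<open>B \<in> BB\<close>]] by blast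
  qed
  finally have "card (clique V) = 4 * card BB" unfolding cover by simp
  then have "card V choose 2 = 4 * card BB" using card_clique finite_V by metis
  moreover have "even (card V * (card V - 1))" using card_V by (cases "even (card V)") simp_all
  ultimately show ?thesis by (simp only: choose_two) presburger
qed

text \<open>With c blocks at a vertex, v = 2c + 1, and counting edges gives 4b = (2c + 1)c for b
  blocks. As 2c + 1 is odd, 4 divides c.\<close>

lemma order:
  obtains k where "card V = 8 * k + 1" "card BB = k * (8 * k + 1)" "k > 0"
    "\<And>q. q \<in> V \<Longrightarrow> card (blocks_at q) = 4 * k"
proof -
  obtain q where "q \<in> V" using card_V by fastforce
  define c where "c = card (blocks_at q)"
  have v: "card V = 2 * c + 1" using card_blocks_at[OF \<open>q \<in> V\<close>] card_V c_def by simp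
  have b: "4 * card BB = (2 * c + 1) * c" using card_blocks v by simp
  then have "4 dvd (2 * c + 1) * c" by (metis dvd_triv_left)
  moreover have "coprime 4 (2 * c + 1)"
  proof -
    have "coprime (2 ^ 2) (2 * c + 1)" by (subst coprime_power_left_iff) simp
    then show ?thesis by simp
  qed
  ultimately have "4 dvd c" by (simp only: coprime_dvd_mult_right_iff)
  then obtain k where k: "c = 4 * k" by blast
  show ?thesis
  proof (rule that[of k])
    show "card V = 8 * k + 1" using v k by simp
    show "card BB = k * (8 * k + 1)" using b k by simp
    show "k > 0" using card_V v k by auto
    show "card (blocks_at r) = 4 * k" if "r \<in> V" for r
      using card_blocks_at[OF that] v k by simp
  qed
qed

lemma odd_order: "odd (card V)" "card V \<ge> 9"
  by (rule order; simp)+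

text \<open>The alternatives are k = 0, 1, 2 modulo 3 for v = 8k + 1. From this table the residue of
  the number of vertices that are not heads is read off.\<close>

lemma order_mod_3:
  assumes "q \<in> V"
  shows "card V mod 3 = 1 \<and> card BB mod 3 = 0 \<and> card (BB - blocks_at q) mod 3 = 0
    \<or> card V mod 3 = 0 \<and> card BB mod 3 = 0 \<and> card (BB - blocks_at q) mod 3 = 2
    \<or> card V mod 3 = 2 \<and> card BB mod 3 = 1"
proof -
  obtain k where k: "card V = 8 * k + 1" "card BB = k * (8 * k + 1)" "card (blocks_at q) = 4 * k" "k > 0"
    using order assms by metis
  have "card (BB - blocks_at q) = k * (8 * k + 1) - 4 * k"
    using blocks_at_subset k by (simp add: card_Diff_subset)
  also have "\<dots> = k * (8 * k - 3)" using \<open>k > 0\<close> by (simp add: algebra_simps)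
  \<comment> \<open>Moving \<open>3 * k\<close> to the left removes the truncated subtraction and
    keeps the residue modulo 3.\<close>
  finally have d: "card (BB - blocks_at q) + 3 * k = 8 * k * k" 
    using \<open>k > 0\<close> by (simp add: algebra_simps)
  have d3: "card (BB - blocks_at q) mod 3 = (8 * k * k) mod 3"
    unfolding d[symmetric] by simp
  have m: "(8 * k * k) mod 3 = (8 * (k mod 3) * (k mod 3)) mod 3"
    "(k * (8 * k + 1)) mod 3 = ((k mod 3) * (8 * (k mod 3) + 1)) mod 3"
    "(8 * k + 1) mod 3 = (8 * (k mod 3) + 1) mod 3"
    by (intro mod_mult_cong mod_add_cong; simp)+
  have "k mod 3 < 3" by simp
  then consider "k mod 3 = 0" | "k mod 3 = 1" | "k mod 3 = 2" by linarith
  then show ?thesis unfolding d3 k(1,2) m by cases simp_all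
qed

end

text \<open>Subtraction modulo 3 without truncation: \<open>- b\<close> is congruent to
  \<open>2 * b\<close>.\<close>

lemma mod_3_summand:
  fixes a b c :: nat
  assumes "a + b = c"
  shows "a mod 3 = (c mod 3 + 2 * (b mod 3)) mod 3"
proof -
  have "(c mod 3 + 2 * (b mod 3)) mod 3 = (c + 2 * b) mod 3"
    by (intro mod_add_cong mod_mult_cong) simp_all
  also have "c + 2 * b = a + 3 * b" using assms by simp
  finally show ?thesis by simp
qed

lemma outer_clique_join:
  assumes "X \<inter> V = {}"
  shows "(clique X \<union> join X W) \<inter> Pow V = {}"
  using assms by (auto simp: mem_clique mem_join) blast+

section \<open>Two, three and four new vertices\<close>

context c4_design
begin

lemma card_nonheads:
  assumes "heads h R" "h ` R \<subseteq> S" "finite S"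
  shows "card (S - h ` R) + card R = card S"
proof -
  have "card (h ` R) = card R" using assms unfolding heads_def by (simp add: card_image)
  then show ?thesis using assms(2,3) by (metis card_Diff_subset card_mono finite_subset le_add_diff_inverse2)
qed

lemma heads_image_subset: "heads h R \<Longrightarrow> h ` R \<subseteq> V"
  unfolding heads_def using sub_V by blast

lemma absorbs_extend:
  assumes "absorbs (A - R) {}" "absorbs R E" "R \<subseteq> A" "A \<subseteq> BB" "E \<inter> Pow V = {}"
  shows "absorbs A E"
proof -
  have "absorbs (R \<union> (A - R)) (E \<union> {})"
    by (rule absorbs_Un[OF assms(2,1)]) (use assms in auto)
  then show ?thesis using assms(3) by (simp add: Un_absorb1)
qed

lemma absorbs_add:
  assumes "absorbs A E" "P4dec F" "A \<subseteq> BB" "E \<inter> F = {}" "E \<inter> Pow V = {}" "F \<inter> Pow V = {}"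
  shows "absorbs A (E \<union> F)"
  using absorbs_Un[of A E "{}" F] assms by simp

lemma card_remaining:
  assumes "absorbs (A - R) {}" "R \<subseteq> A" "A \<subseteq> BB"
  shows "card R mod 3 = card A mod 3"
proof -
  have "3 dvd card (A - R)" using absorbs_card[OF assms(1)] assms(3) by blast
  moreover have "card A = card R + card (A - R)"
    using assms(2,3) finite_BB by (metis card_Diff_subset card_mono finite_subset le_add_diff_inverse)
  ultimately show ?thesis by (metis add.right_neutral dvd_imp_mod_0 mod_add_right_eq)
qed

text \<open>Orders congruent to 1 and 2 come with 0 and 1 blocks modulo 3. In both cases the number
  of vertices that are not heads is 1 modulo 3, which is what the edge \<open>{x, y}\<close>
  requires.\<close>

lemma absorbs_two_new_vertices:
  assumes "card V mod 3 \<noteq> 0" "x \<noteq> y" "{x, y} \<inter> V = {}"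
  shows "absorbs BB (clique {x, y} \<union> join {x, y} V)"
proof -
  interpret c4_family_two V BB x y using assms by unfold_locales auto
  obtain R h where R: "R \<subseteq> BB" "heads h R" "absorbs (BB - R) {}"
    using head_system[OF subset_refl] by metis
  have c: "card (V - h ` R) + card R = card V"
    using card_nonheads[OF R(2) heads_image_subset[OF R(2)] finite_V] .
  have r: "card R mod 3 = card BB mod 3" using card_remaining[OF R(3,1)] by blast
  obtain q where "q \<in> V" using card_V by fastforce
  have "card (V - h ` R) mod 3 = 1"
    using order_mod_3[OF \<open>q \<in> V\<close>] assms(1) unfolding mod_3_summand[OF c] r by auto
  then have "absorbs R (insert {x, y} (join {x, y} V))"
    using R(2) heads_image_subset odd_order card_V by (intro absorbs_join_edge) auto
  moreover have "insert {x, y} (join {x, y} V) = clique {x, y} \<union> join {x, y} V"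
    using assms(2) by (simp add: clique_2)
  ultimately show ?thesis
    using absorbs_extend[OF R(3)] R(1) outer_clique_join[OF assms(3)] by simp
qed

text \<open>
  A block through \<open>q\<close>, in which \<open>q\<close> has the neighbours \<open>a\<close> and \<open>b\<close>, gives up the first edge of the
  path \<open>q a z b\<close>.
\<close>

lemma absorbs_blocks_at:
  assumes q: "q \<in> V" and z: "z \<notin> V"
  shows "absorbs (blocks_at q) (join {z} (V - {q}))"
proof -
  \<comment> \<open>The neighbours of \<open>q\<close> along the blocks in \<open>A\<close>, so that
    the claim can be proved by adding one block at a time. Each block contributes a new pair, and
    all blocks at \<open>q\<close> together give \<open>V - {q}\<close>.\<close>
  define N where "N A = {a. a \<noteq> q \<and> (\<exists>B\<in>A. {q, a} \<in> B)}" for A :: "'a set set set"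
  have N_V: "N A \<subseteq> V" if "A \<subseteq> BB" for A using that sub_V unfolding N_def by blast
  have "absorbs A (join {z} (N A))" if "A \<subseteq> blocks_at q" for A
    using finite_subset[OF that blocks_at_subset(2)] that
  proof (induction rule: finite_induct)
    case empty
    show ?case by (simp add: N_def P4dec_empty)
  next
    case (insert B A)
    have sub: "B \<in> BB" "A \<subseteq> BB" "q \<in> \<Union>B" using insert.prems unfolding blocks_at_def by auto
    obtain a b where ab: "a \<noteq> b" "a \<noteq> q" "b \<noteq> q" and e: "{e \<in> B. q \<in> e} = {{q, a}, {q, b}}"
      using C4_two_neighbours[OF C4[OF sub(1)] sub(3)] .
    have N_B: "N {B} = {a, b}"
    proof -
      have "{q, c} \<in> B \<longleftrightarrow> {q, c} \<in> {e \<in> B. q \<in> e}" for c by simp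
      then have "{q, c} \<in> B \<longleftrightarrow> {q, c} = {q, a} \<or> {q, c} = {q, b}" for c
        unfolding e by simp
      then show ?thesis unfolding N_def using ab by (auto simp: doubleton_eq_iff)
    qed
    have "{a, b} \<subseteq> V" using N_V[of "{B}"] N_B sub(1) by simp
    have "{q, a} \<in> {e \<in> B. q \<in> e}" unfolding e by simp
    then have "{q, a} \<in> B" by simp
    have disjoint: "N {B} \<inter> N A = {}"
      using block_unique[of _ B] insert.hyps(2) sub(1,2) unfolding N_def by blast
    have "P4dec ({{q, a}, {a, z}, {z, b}} \<union> {})"
      by (rule P4dec_insert[OF P4dec_empty]) (use ab \<open>{a, b} \<subseteq> V\<close> q z in auto)
    then have "P4dec (insert {q, a} (join {z} {a, b}))"
      by (simp add: join_insert insert_commute)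
    then have "absorbs {B} (join {z} (N {B}))"
      unfolding N_B by (rule absorbs_single[OF \<open>{q, a} \<in> B\<close>])
    then have "absorbs ({B} \<union> A) (join {z} (N {B}) \<union> join {z} (N A))"
      using insert sub disjoint N_V z
      by (intro absorbs_Un join_disjoint[of _ V] join_outer) auto
    moreover have "N (insert B A) = N {B} \<union> N A" unfolding N_def by auto
    ultimately show ?case by (simp add: join_Un_right)
  qed
  then have "absorbs (blocks_at q) (join {z} (N (blocks_at q)))" by simp
  moreover have "N (blocks_at q) = V - {q}"
  proof
    show "N (blocks_at q) \<subseteq> V - {q}"
      using N_V[OF blocks_at_subset(1)] unfolding N_def by blast
    show "V - {q} \<subseteq> N (blocks_at q)"
    proof
      fix a assume "a \<in> V - {q}"
      then have "{q, a} \<in> \<Union>BB" using q unfolding cover mem_clique by blast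
      then show "a \<in> N (blocks_at q)"
        using \<open>a \<in> V - {q}\<close> unfolding N_def blocks_at_def by blast
    qed
  qed
  ultimately show ?thesis by simp
qed

text \<open>The blocks through a vertex \<open>q\<close> pay for the edges from \<open>z\<close> to
  the other old vertices. The remaining blocks avoid \<open>q\<close>, so their heads lie in
  \<open>V - {q}\<close>, which \<open>x\<close> and \<open>y\<close> serve. What is left is K_4 on
  \<open>x\<close>, \<open>y\<close>, \<open>z\<close>, \<open>q\<close>.\<close>

lemma absorbs_three_new_vertices:
  assumes "card V mod 3 \<noteq> 2" and xyz: "distinct [x, y, z]" "{x, y, z} \<inter> V = {}"
  shows "absorbs BB (clique {x, y, z} \<union> join {x, y, z} V)"
proof -
  interpret c4_family_two V BB x y using xyz by unfold_locales auto
  obtain q where q: "q \<in> V" using card_V by fastforce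
  let ?A = "BB - blocks_at q"
  obtain R h where R: "R \<subseteq> ?A" "heads h R" "absorbs (?A - R) {}"
    using head_system[of ?A] by (metis Diff_subset)
  have im: "h ` R \<subseteq> V - {q}"
    using heads_image_subset[OF R(2)] R(1,2) unfolding heads_def blocks_at_def by blast
  have c: "card (V - {q} - h ` R) + card R = card (V - {q})"
    using card_nonheads[OF R(2) im] finite_V by simp
  have cq: "card (V - {q}) + 1 = card V" using q finite_V card_V by simp
  have r: "card R mod 3 = card ?A mod 3" using card_remaining[OF R(3,1)] by blast
  have dvd: "3 dvd card (V - {q} - h ` R)"
    using order_mod_3[OF q] assms(1)
    unfolding dvd_eq_mod_eq_0 mod_3_summand[OF c] mod_3_summand[OF cq] r by auto
  \<comment> \<open>\<open>V - {q}\<close> has even size, so an odd number of heads cannot fill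
    it.\<close>
  have ne: "even (card R) \<or> V - {q} \<noteq> h ` R"
    using card_heads[OF R(2)] cq odd_order(1) by (metis even_plus_one_iff)
  have "absorbs R (join {x, y} (V - {q}))"
    by (rule absorbs_join[OF R(2) im _ dvd ne]) blast
  then have A: "absorbs ?A (join {x, y} (V - {q}))"
    using absorbs_extend[OF R(3)] R(1) join_out by blast
  have "join {x, y} (V - {q}) \<inter> join {z} (V - {q}) = {}"
    using xyz by (auto simp: mem_join doubleton_eq_iff)
  then have "absorbs (?A \<union> blocks_at q) (join {x, y} (V - {q}) \<union> join {z} (V - {q}))"
    using q xyz blocks_at_subset(1)
    by (intro absorbs_Un A absorbs_blocks_at join_outer) auto
  moreover have "?A \<union> blocks_at q = BB" using blocks_at_subset(1) by blast
  moreover have "join {x, y} (V - {q}) \<union> join {z} (V - {q}) = join {x, y, z} (V - {q})"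
    by (simp add: insert_commute flip: join_Un_left)
  ultimately have B: "absorbs BB (join {x, y, z} (V - {q}))" by simp
  have q_out: "q \<notin> {x, y, z}" using q xyz(2) by blast
  have "P4dec (clique {x, y, z, q})" by (rule P4dec_K4) (use q_out xyz in auto)
  moreover have "{x, y, z, q} = {x, y, z} \<union> {q}" by blast
  ultimately have "P4dec (clique ({x, y, z} \<union> {q}))" by simp
  then have K: "P4dec (clique {x, y, z} \<union> join {x, y, z} {q})"
    using clique_Un[of "{x, y, z}" "{q}"] q_out clique_insert[of q "{}"] by simp
  have dq: "join {x, y, z} (V - {q}) \<inter> join {x, y, z} {q} = {}"
    using xyz(2) q by (intro join_disjoint[of _ V]) auto
  have dk: "clique {x, y, z} \<inter> join {x, y, z} (V - {q}) = {}"
    using xyz(2) by (intro clique_join_disjoint) blast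
  have "absorbs BB (join {x, y, z} (V - {q}) \<union> (clique {x, y, z} \<union> join {x, y, z} {q}))"
  proof (rule absorbs_add[OF B K subset_refl])
    show "join {x, y, z} (V - {q}) \<inter> (clique {x, y, z} \<union> join {x, y, z} {q}) = {}"
      using dq dk by blast
    show "(clique {x, y, z} \<union> join {x, y, z} {q}) \<inter> Pow V = {}"
      using outer_clique_join[OF xyz(2)] join_outer[OF xyz(2)] by blast
  qed (rule join_outer[OF xyz(2)])
  moreover have "(V - {q}) \<union> {q} = V" using q by blast
  ultimately show ?thesis by (simp only: Un_ac flip: join_Un_right)
qed

text \<open>If all vertices were heads, their odd number could not be paired and no vertex would be
  left for the last one; hence \<open>q\<close> is excluded as a head. The vertices \<open>z\<close>
  and \<open>t\<close> meet no deleted edge: 3 divides \<open>card V\<close>, so their edges to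
  \<open>V\<close> split on their own, as does K_4 on the new vertices.\<close>

lemma absorbs_four_new_vertices:
  assumes "card V mod 3 = 0" and xyzt: "distinct [x, y, z, t]" "{x, y, z, t} \<inter> V = {}"
  shows "absorbs BB (clique {x, y, z, t} \<union> join {x, y, z, t} V)"
proof -
  interpret c4_family_two V BB x y using xyzt by unfold_locales auto
  obtain q where q: "q \<in> V" using card_V by fastforce
  obtain R h where R: "R \<subseteq> BB" "heads h R" "q \<notin> h ` R" "absorbs (BB - R) {}"
    using head_system[OF subset_refl] by metis
  have c: "card (V - h ` R) + card R = card V"
    using card_nonheads[OF R(2) heads_image_subset[OF R(2)] finite_V] .
  have r: "card R mod 3 = card BB mod 3" using card_remaining[OF R(4,1)] by blast
  have "3 dvd card (V - h ` R)"
    using order_mod_3[OF q] assms(1) unfolding dvd_eq_mod_eq_0 mod_3_summand[OF c] r by auto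
  then have "absorbs R (join {x, y} V)"
    using R q by (intro absorbs_join[OF R(2) heads_image_subset]) auto
  then have "absorbs BB (join {x, y} V)"
    using absorbs_extend[OF R(4) _ R(1)] join_out by blast
  moreover have "P4dec (join {z, t} V)"
    using assms(1) xyzt by (intro P4dec_join2 finite_V) auto
  moreover have "join {x, y} V \<inter> join {z, t} V = {}"
    using xyzt by (auto simp: mem_join doubleton_eq_iff)
  moreover have "join {z, t} V \<inter> Pow V = {}"
    using xyzt(2) by (intro join_outer) blast
  ultimately have "absorbs BB (join {x, y} V \<union> join {z, t} V)"
    using join_out by (intro absorbs_add) auto
  moreover have "join {x, y} V \<union> join {z, t} V = join {x, y, z, t} V"
    by (simp only: Un_insert_left Un_empty_left flip: join_Un_left)
  ultimately have "absorbs BB (join {x, y, z, t} V)" by simp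
  then have "absorbs BB (join {x, y, z, t} V \<union> clique {x, y, z, t})"
    using clique_join_disjoint[OF xyzt(2)] outer_clique_join[OF xyzt(2)] P4dec_K4[OF xyzt(1)]
    by (intro absorbs_add) blast+
  then show ?thesis by (simp add: Un_commute)
qed

end

lemma card_Diff_add: "finite W \<Longrightarrow> T \<subseteq> W \<Longrightarrow> card (W - T) + card T = card W"
  by (metis card_Diff_subset card_mono finite_subset le_add_diff_inverse2)

section \<open>Any number of new vertices from two on\<close>

context c4_design
begin

lemma clique_diff_outer: "(clique W - clique V) \<inter> Pow V = {}"
  by (auto simp: clique_def)

lemma clique_extend:
  assumes "V \<subseteq> W" "X \<inter> W = {}"
  shows "clique (W \<union> X) - clique V = (clique W - clique V) \<union> (clique X \<union> join X W)"
proof -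
  have "clique (W \<union> X) = clique X \<union> clique W \<union> join X W"
    using clique_Un[OF assms(2)] by (simp add: Un_commute)
  moreover have "(clique X \<union> join X W) \<inter> Pow V = {}"
    using assms by (intro outer_clique_join) blast
  then have "(clique X \<union> join X W) \<inter> clique V = {}"
    unfolding clique_def by blast
  ultimately show ?thesis by blast
qed

lemma clique_extend_V: "X \<inter> V = {} \<Longrightarrow> clique (V \<union> X) - clique V = clique X \<union> join X V"
  using clique_extend[OF subset_refl] by simp

lemma absorbs_extend_clique:
  assumes "absorbs BB (clique W - clique V)" "V \<subseteq> W" "X \<inter> W = {}" "P4dec (clique X \<union> join X W)"
  shows "absorbs BB (clique (W \<union> X) - clique V)"
  unfolding clique_extend[OF assms(2,3)]
proof (rule absorbs_add[OF assms(1,4) subset_refl _ clique_diff_outer])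
  show "(clique W - clique V) \<inter> (clique X \<union> join X W) = {}"
    using outer_clique_join[OF assms(3), of W] unfolding clique_def by blast
  show "(clique X \<union> join X W) \<inter> Pow V = {}"
    using assms(2,3) by (intro outer_clique_join) blast
qed

text \<open>From five new vertices on, splitting off three keeps the residue modulo 3 and leaves at
  least two, so only two, three and four have to be treated directly.\<close>

lemma absorbs_clique:
  assumes "finite W" "V \<subseteq> W" "card W \<ge> card V + 2" "card W mod 3 = 0 \<or> card W mod 3 = 1"
  shows "absorbs BB (clique W - clique V)"
  using assms
proof (induction "card W" arbitrary: W rule: less_induct)
  case less
  let ?X = "W - V"
  have card: "card W = card V + card ?X"
    using card_Diff_add[OF less.prems(1,2)] by simp
  have WX: "W = V \<union> ?X" using less.prems(2) by blast
  have large: "card V \<ge> 9" by (rule odd_order)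
  have three: "?case" if small: "absorbs BB (clique (W - T) - clique V)"
    and T: "T \<subseteq> ?X" "card T = 3" for T
  proof -
    obtain x y z where xyz: "T = {x, y, z}" "distinct [x, y, z]"
      using T(2) by (metis card_3_iff distinct_length_2_or_more distinct_singleton)
    have "card (W - T) + 3 = card W"
      using card_Diff_add[of W T] T less.prems(1) by auto
    then have "card (W - T) mod 3 = card W mod 3" by (metis mod_add_self2)
    moreover have "V \<noteq> {}" using card_V by auto
    then have "W - T \<noteq> {}" using T(1) less.prems(2) by blast
    ultimately have "P4dec (clique T \<union> join T (W - T))"
      unfolding xyz(1) using less.prems(1,4) xyz(2)
      by (intro P4dec_three_new_vertices) auto
    then have "absorbs BB (clique ((W - T) \<union> T) - clique V)"
      using T(1) less.prems(2) by (intro absorbs_extend_clique[OF small]) auto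
    moreover have "(W - T) \<union> T = W" using T(1) by blast
    ultimately show ?case by simp
  qed
  have via_X: ?case if "absorbs BB (clique ?X \<union> join ?X V)"
  proof -
    have "?X \<inter> V = {}" by blast
    then show ?case using that clique_extend_V[of ?X] WX by metis
  qed
  consider "card ?X = 2" | "card ?X = 3" | "card ?X = 4" | "card ?X \<ge> 5"
    using card less.prems(3) by linarith
  then show ?case
  proof cases
    case 1
    then obtain x y where xy: "?X = {x, y}" "x \<noteq> y" by (meson card_2_iff)
    have "card V mod 3 \<noteq> 0" using card 1 less.prems(4) by presburger
    then have "absorbs BB (clique {x, y} \<union> join {x, y} V)"
      by (rule absorbs_two_new_vertices) (use xy in auto)
    then show ?thesis by (intro via_X) (simp only: xy(1))
  next
    case 2
    then obtain x y z where xyz: "?X = {x, y, z}" "distinct [x, y, z]"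
      by (metis card_3_iff distinct_length_2_or_more distinct_singleton)
    have "card V mod 3 \<noteq> 2" using card 2 less.prems(4) by presburger
    then have "absorbs BB (clique {x, y, z} \<union> join {x, y, z} V)"
      by (rule absorbs_three_new_vertices) (use xyz in auto)
    then show ?thesis by (intro via_X) (simp only: xyz(1))
  next
    case 3
    then obtain x T where xT: "?X = insert x T" "x \<notin> T" "card T = 3"
      using card_Suc_eq[of ?X 3] by auto
    then obtain y z t where yzt: "T = {y, z, t}" "distinct [y, z, t]"
      by (metis card_3_iff distinct_length_2_or_more distinct_singleton)
    have d: "distinct [x, y, z, t]" and X: "?X = {x, y, z, t}" using xT yzt by auto
    have out: "{x, y, z, t} \<inter> V = {}" using X by blast
    show ?thesis
    proof (cases "card V mod 3 = 0")
      case True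
      then have "absorbs BB (clique {x, y, z, t} \<union> join {x, y, z, t} V)"
        by (rule absorbs_four_new_vertices[OF _ d out])
      then show ?thesis by (intro via_X) (simp only: X)
    next
      case False
      \<comment> \<open>For this residue the four vertices are added as two and two:
        \<open>card V + 2\<close> is congruent to 1, so the second pair needs no deleted
        edges.\<close>
      have v: "card V mod 3 = 2" using card 3 less.prems(4) False by presburger
      let ?W = "V \<union> {x, y}"
      have cW: "card ?W = card V + 2"
        using d out finite_V by (subst card_Un_disjoint) auto
      have small: "absorbs BB (clique ?W - clique V)"
      proof (rule less.hyps)
        show "card ?W < card W" using cW card 3 by simp
        show "card ?W mod 3 = 0 \<or> card ?W mod 3 = 1" using cW v by presburger
      qed (use cW finite_V in auto)
      have "P4dec (clique {z, t} \<union> join {z, t} ?W)"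
      proof (rule P4dec_two_new_vertices)
        show "card ?W mod 3 = 1" using cW v by presburger
      qed (use cW finite_V large d out in auto)
      then have "absorbs BB (clique (?W \<union> {z, t}) - clique V)"
        using d out by (intro absorbs_extend_clique[OF small]) auto
      moreover have "?W \<union> {z, t} = W" using WX X by blast
      ultimately show ?thesis by simp
    qed
  next
    case 4
    then obtain T where T: "T \<subseteq> ?X" "card T = 3"
      using obtain_subset_with_card_n[of 3 ?X] by auto
    have c: "card (W - T) + 3 = card W"
      using card_Diff_add[of W T] T less.prems(1) by auto
    have "absorbs BB (clique (W - T) - clique V)"
    proof (rule less.hyps)
      show "card (W - T) mod 3 = 0 \<or> card (W - T) mod 3 = 1"
        using c less.prems(4) by (metis mod_add_self2)
      show "card (W - T) < card W" "card V + 2 \<le> card (W - T)" using c card 4 by linarith+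
    qed (use less.prems T(1) in auto)
    then show ?thesis using three T by blast
  qed
qed

end

section \<open>A cyclic 4-cycle design\<close>

text \<open>\<open>absorbs\<close> wants a choice that depends on the block itself, whereas cyclic
  blocks and their deleted edges are given by an index.\<close>

lemma absorbs_imageI:
  assumes "inj_on b I" "\<And>i. i \<in> I \<Longrightarrow> c i \<in> b i" "P4dec (c ` I \<union> E)"
  shows "absorbs (b ` I) E"
proof -
  have "(\<lambda>B. c (inv_into I b B)) ` b ` I = c ` I"
    using assms(1) by (simp add: image_image)
  moreover have "\<forall>B\<in>b ` I. c (inv_into I b B) \<in> B"
    using assms(1,2) by simp
  ultimately show ?thesis
    unfolding absorbs_def using assms(3) by (intro exI[of _ "\<lambda>B. c (inv_into I b B)"]) simp
qed

lemma P4dec_path: "distinct [a, b, c, d] \<Longrightarrow> P4dec {{a, b}, {b, c}, {c, d}}"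
  using P4dec_insert[OF P4dec_empty, of a b c d] by simp

text \<open>\<open>g\<close> labels the residues modulo \<open>8 * k + 1\<close> by vertices. Having
  it on all integers permits translates and negative offsets without explicit reduction.\<close>

locale cyclic =
  fixes g :: "int \<Rightarrow> 'a" and k :: int
  assumes k: "k \<ge> 1" and g_eq: "g i = g j \<longleftrightarrow> (8 * k + 1) dvd (i - j)"
begin

abbreviation "v \<equiv> 8 * k + 1"

definition E :: "int \<Rightarrow> int \<Rightarrow> 'a set" where
  "E i d = {g i, g (i + d)}"

definition V :: "'a set" where
  "V = range g"

lemma dvd_small: "v dvd a \<Longrightarrow> \<bar>a\<bar> < v \<Longrightarrow> a = 0"
  using dvd_imp_le_int[of a v] by force

lemma g_neq: "i \<noteq> j \<Longrightarrow> \<bar>i - j\<bar> < v \<Longrightarrow> g i \<noteq> g j"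
  unfolding g_eq using dvd_small[of "i - j"] by auto

lemma g_mod: "g (i mod v) = g i"
  unfolding g_eq by (metis dvd_minus_mod dvd_minus_iff minus_diff_eq)

lemma mod_in_range: "i mod v \<in> {0..<v}"
  unfolding atLeastLessThan_iff using k by (intro conjI pos_mod_sign pos_mod_bound) linarith+

lemma E_mod: "E (i mod v) d = E i d"
proof -
  have "v dvd (i mod v + d) - (i + d)"
    using g_eq[of "i mod v" i] g_mod[of i] by simp
  then show ?thesis unfolding E_def g_mod by (simp only: g_eq[symmetric])
qed

text \<open>Differences up to \<open>4 * k\<close> are below half the order. Matching the ends
  crosswise would make \<open>v\<close> divide \<open>d + d'\<close>, which lies strictly between 0
  and \<open>v\<close>.\<close>

lemma E_eq:
  assumes "1 \<le> d" "d \<le> 4 * k" "1 \<le> d'" "d' \<le> 4 * k"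
  shows "E i d = E i' d' \<longleftrightarrow> v dvd (i - i') \<and> d = d'"
proof
  assume "E i d = E i' d'"
  then consider "v dvd i - i'" "v dvd (i + d) - (i' + d')"
    | "v dvd i - (i' + d')" "v dvd (i + d) - i'"
    unfolding E_def by (auto simp: doubleton_eq_iff g_eq)
  then show "v dvd (i - i') \<and> d = d'"
  proof cases
    case 1
    then have "v dvd ((i + d) - (i' + d')) - (i - i')" by (rule dvd_diff[rotated])
    then have "v dvd d - d'" by (simp add: algebra_simps)
    then show ?thesis using dvd_small[of "d - d'"] assms 1 by auto
  next
    case 2
    then have "v dvd ((i + d) - i') - (i - (i' + d'))" by (rule dvd_diff[rotated])
    then have "v dvd d + d'" by (simp add: algebra_simps)
    then show ?thesis using dvd_small[of "d + d'"] assms by auto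
  qed
next
  assume *: "v dvd (i - i') \<and> d = d'"
  then have "v dvd (i + d) - (i' + d')" by simp
  then show "E i d = E i' d'" using * unfolding E_def g_eq[symmetric] by metis
qed

lemma V_eq: "V = g ` {0..<v}"
proof -
  have "g i \<in> g ` {0..<v}" for i
    using g_mod[of i] mod_in_range[of i] by (metis imageI)
  then show ?thesis unfolding V_def by auto
qed

lemma card_V: "card V = nat v" "finite V"
proof -
  have "inj_on g {0..<v}"
    using g_neq by (intro inj_onI) fastforce
  then show "card V = nat v" unfolding V_eq by (simp add: card_image)
  show "finite V" unfolding V_eq by simp
qed

text \<open>Read in the opposite direction, an edge of difference \<open>d\<close> has difference
  \<open>v - d\<close>, and one of these is at most \<open>4 * k\<close>.\<close>

lemma in_clique_V:
  assumes "e \<in> clique V"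
  obtains i d where "1 \<le> d" "d \<le> 4 * k" "e = E i d"
proof -
  obtain a b where "g a \<noteq> g b" and e: "e = {g a, g b}"
    using assms unfolding mem_clique V_def by blast
  define d where "d = (b - a) mod v"
  have d: "0 \<le> d" "d < v" using mod_in_range[of "b - a"] unfolding d_def by auto
  have "v dvd (b - a) - d" unfolding d_def by (rule dvd_minus_mod)
  then have gb: "g b = g (a + d)" unfolding g_eq by (simp add: algebra_simps)
  then have "d \<noteq> 0" using \<open>g a \<noteq> g b\<close> by auto
  show ?thesis
  proof (cases "d \<le> 4 * k")
    case True
    then show ?thesis using that[of d a] d \<open>d \<noteq> 0\<close> e gb unfolding E_def by simp
  next
    case False
    have "g (a + d + (v - d)) = g a" unfolding g_eq by simp
    then have "e = E (a + d) (v - d)" unfolding e gb E_def by (simp add: insert_commute)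
    then show ?thesis using that[of "v - d" "a + d"] d False by simp
  qed
qed

lemma E_in_clique: "1 \<le> d \<Longrightarrow> d \<le> 4 * k \<Longrightarrow> E i d \<in> clique V"
  unfolding mem_clique V_def E_def using g_neq[of i "i + d"] by fastforce

text \<open>
  \<open>block (j, i)\<close> is the translate by \<open>i\<close> of the 4-cycle \<open>(0, 4j + 1, -1, 4j + 3)\<close>, whose edges have the
  differences \<open>4j + 1, \<dots>, 4j + 4\<close>; those with even difference start at \<open>-1\<close>, the others at \<open>0\<close>.
\<close>

definition block :: "int \<times> int \<Rightarrow> 'a set set" where
  "block = (\<lambda>(j, i). (\<lambda>t. E (i - (if even t then 1 else 0)) (4 * j + t)) ` {1..4})"

abbreviation "I \<equiv> {0..<k} \<times> {0..<v}"

definition BB :: "'a set set set" where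
  "BB = block ` I"

lemma block_edges:
  "block (j, i) = {{g i, g (i + 4 * j + 1)}, {g (i + 4 * j + 1), g (i - 1)},
    {g (i - 1), g (i + 4 * j + 3)}, {g (i + 4 * j + 3), g i}}"
proof -
  have "{1..4 :: int} = {1, 2, 3, 4}" by auto
  then have "block (j, i) = {E i (4 * j + 1), E (i - 1) (4 * j + 2), E i (4 * j + 3), E (i - 1) (4 * j + 4)}"
    unfolding block_def by simp
  also have "E i (4 * j + 1) = {g i, g (i + 4 * j + 1)}"
    unfolding E_def by (simp add: add.assoc)
  also have "E (i - 1) (4 * j + 2) = {g (i + 4 * j + 1), g (i - 1)}"
    unfolding E_def by (simp add: insert_commute algebra_simps)
  also have "E i (4 * j + 3) = {g (i + 4 * j + 3), g i}"
    unfolding E_def by (simp add: insert_commute algebra_simps)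
  also have "E (i - 1) (4 * j + 4) = {g (i - 1), g (i + 4 * j + 3)}"
    unfolding E_def by (simp add: algebra_simps)
  finally show ?thesis by (simp only: insert_commute)
qed

lemma block_C4:
  assumes "0 \<le> j" "j < k"
  shows "is_C4 (block (j, i))"
  unfolding block_edges is_C4_def
proof (intro exI conjI)
  show "distinct [g i, g (i + 4 * j + 1), g (i - 1), g (i + 4 * j + 3)]"
    using g_neq[of i "i + 4 * j + 1"] g_neq[of i "i - 1"] g_neq[of i "i + 4 * j + 3"]
      g_neq[of "i + 4 * j + 1" "i - 1"] g_neq[of "i + 4 * j + 1" "i + 4 * j + 3"]
      g_neq[of "i - 1" "i + 4 * j + 3"] assms by simp
qed (rule refl)

text \<open>The difference \<open>4 * j + t\<close> of \<open>e\<close>, with \<open>t\<close> from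
  1 to 4, determines \<open>j\<close> and \<open>t\<close>; then the starting point determines
  \<open>i\<close> modulo \<open>v\<close>.\<close>

lemma block_index:
  assumes "x \<in> I" "y \<in> I" "e \<in> block x" "e \<in> block y"
  shows "x = y"
proof -
  obtain j i j' i' where x: "x = (j, i)" and y: "y = (j', i')" by fastforce
  obtain t where t: "t \<in> {1..4}" "e = E (i - (if even t then 1 else 0)) (4 * j + t)"
    using assms(3) unfolding x block_def by auto
  obtain t' where t': "t' \<in> {1..4}" "e = E (i' - (if even t' then 1 else 0)) (4 * j' + t')"
    using assms(4) unfolding y block_def by auto
  have "v dvd (i - (if even t then 1 else 0)) - (i' - (if even t' then 1 else 0)) \<and> 4 * j + t = 4 * j' + t'"
    using t t' assms(1,2) by (subst E_eq[symmetric]) (auto simp: x y)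
  then have d: "v dvd (i - (if even t then 1 else 0)) - (i' - (if even t' then 1 else 0))"
    and jt: "4 * j + t = 4 * j' + t'" by blast+
  have "j = j'" using jt t(1) t'(1) by simp
  then have "t = t'" using jt by simp
  then have "v dvd i - i'" using d by simp
  then have "i = i'" using dvd_small[of "i - i'"] assms(1,2) x y by auto
  then show ?thesis using \<open>j = j'\<close> x y by simp
qed

lemma inj_block: "inj_on block I"
proof (rule inj_onI)
  fix x y assume *: "x \<in> I" "y \<in> I" "block x = block y"
  have "block x \<noteq> {}" unfolding block_def by (cases x) simp
  then show "x = y" using block_index[OF *(1,2)] *(3) by blast
qed

sublocale c4_design V BB
proof
  show "finite V" by (rule card_V)
  show "finite BB" unfolding BB_def by simp
  show "is_C4 B" if "B \<in> BB" for B using that block_C4 unfolding BB_def by auto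
  show "disjoint BB" unfolding BB_def disjoint_def using block_index by blast
  show "card V > 1" using card_V k by simp
  show cover: "\<Union>BB = clique V"
  proof (intro equalityI subsetI)
    fix e assume "e \<in> \<Union>BB"
    then obtain j i t where "0 \<le> j" "j < k" "t \<in> {1..4}" "e = E (i - (if even t then 1 else 0)) (4 * j + t)"
      unfolding BB_def block_def by auto
    then show "e \<in> clique V" using E_in_clique[of "4 * j + t"] by simp
  next
    fix e assume "e \<in> clique V"
    then obtain i d where d: "1 \<le> d" "d \<le> 4 * k" and e: "e = E i d" by (rule in_clique_V)
    \<comment> \<open>\<open>t\<close> runs from 1 to 4 instead of 0 to 3, hence the shift by
      1.\<close>
    define j t where "j = (d - 1) div 4" and "t = (d - 1) mod 4 + 1"
    have jt: "d = 4 * j + t" "t \<in> {1..4}" "0 \<le> j" "j < k"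
      using d unfolding j_def t_def by auto
    \<comment> \<open>Edges of even difference start one place before the index of their block;
      \<open>s\<close> undoes this.\<close>
    define s :: int where "s = (if even t then 1 else 0)"
    define i' where "i' = (i + s) mod v"
    have "v dvd (i' - s) - i"
    proof -
      have "(i' - s) - i = - ((i + s) - i')" by simp
      then show ?thesis by (simp only: dvd_minus_iff i'_def dvd_minus_mod)
    qed
    then have "e = E (i' - s) (4 * j + t)"
      unfolding e jt(1) using d jt(1) by (subst E_eq) (auto simp: dvd_diff_commute)
    then have "e \<in> block (j, i')" unfolding block_def s_def using jt(2) by auto
    moreover have "(j, i') \<in> I" using jt mod_in_range[of "i + s"] unfolding i'_def by simp
    ultimately show "e \<in> \<Union>BB" unfolding BB_def by blast
  qed
  show "\<Union>B \<subseteq> V" if "B \<in> BB" for B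
  proof -
    have "B \<subseteq> clique V" using that cover by blast
    then show ?thesis unfolding clique_def by blast
  qed
qed

end

lemma disjoint_familyI:
  assumes "\<And>i j e. i \<in> I \<Longrightarrow> j \<in> I \<Longrightarrow> e \<in> S i \<Longrightarrow> e \<in> S j \<Longrightarrow> i = j"
  shows "disjoint_family_on S I"
  using assms unfolding disjoint_family_on_def by blast

lemma three_intervals:
  fixes w :: int
  shows "{0..<3 * w} = (\<Union>i\<in>{0..<w}. (\<lambda>a. 3 * i + a) ` {0..2})"
proof (intro equalityI subsetI)
  fix x assume x: "x \<in> {0..<3 * w}"
  then have "x div 3 \<in> {0..<w}" by auto
  moreover have "x = 3 * (x div 3) + x mod 3" "x mod 3 \<in> {0..2}" by auto
  ultimately show "x \<in> (\<Union>i\<in>{0..<w}. (\<lambda>a. 3 * i + a) ` {0..2})" by blast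
qed auto

lemma three_intervals_image:
  fixes w :: int
  shows "(\<Union>i\<in>{0..<w}. (\<lambda>a. f (3 * i + a)) ` {0..2}) = f ` {0..<3 * w}"
  unfolding three_intervals by (simp only: image_UN image_image)

lemma atLeastAtMost_0_2: "{0..2 :: int} = {0, 1, 2}"
  by auto

text \<open>
  From every block the edge of difference \<open>4j + 1\<close> is deleted, so the deleted edges form \<open>k\<close> full
  difference classes. Three consecutive ones consist of the translates of one path; \<open>k mod 3\<close> of
  them are left over.
\<close>

context cyclic
begin

definition D :: "int \<Rightarrow> 'a set set" where
  "D d = range (\<lambda>i. E i d)"

text \<open>A full class may be run through from any starting point. This aligns edges such as
  \<open>E (i - 4) d\<close> with the path of index \<open>i\<close> that contains them.\<close>

lemma D_shift: "D d = (\<lambda>i. E (i + c) d) ` {0..<v}"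
proof -
  have "E i d = E ((i - c) mod v + c) d" for i
  proof -
    have "((i - c) mod v + c) mod v = i mod v" by (simp add: mod_add_left_eq)
    then show ?thesis by (metis E_mod)
  qed
  then show ?thesis unfolding D_def using mod_in_range by (auto intro!: image_eqI)
qed

lemma D_eq: "D d = (\<lambda>i. E i d) ` {0..<v}"
  using D_shift[of d 0] by simp

lemma D_disjoint:
  assumes "1 \<le> d" "d \<le> 4 * k" "1 \<le> d'" "d' \<le> 4 * k" "d \<noteq> d'"
  shows "D d \<inter> D d' = {}"
  using assms unfolding D_def by (auto simp: E_eq)

lemma same_index: "i \<in> {0..<v} \<Longrightarrow> j \<in> {0..<v} \<Longrightarrow> v dvd i - j \<Longrightarrow> i = j"
  using dvd_small[of "i - j"] by auto

text \<open>The zigzag i, i + d, i - 4, i + d + 4 has the differences \<open>d\<close>,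
  \<open>d + 4\<close>, \<open>d + 8\<close>: each end is moved by 4, the gap between consecutive
  classes.\<close>

lemma P4dec_three_classes:
  assumes "1 \<le> d" "d + 8 \<le> 4 * k"
  shows "P4dec (D d \<union> D (d + 4) \<union> D (d + 8))"
proof -
  define S where "S i = {E i d, E (i - 4) (d + 4), E (i - 4) (d + 8)}" for i
  have path: "P4dec (S i)" for i
  proof -
    have "distinct [g i, g (i + d), g (i - 4), g (i + d + 4)]"
      using g_neq[of i "i + d"] g_neq[of i "i - 4"] g_neq[of i "i + d + 4"]
        g_neq[of "i + d" "i - 4"] g_neq[of "i + d" "i + d + 4"] g_neq[of "i - 4" "i + d + 4"] assms
      by simp
    then have "P4dec {{g i, g (i + d)}, {g (i + d), g (i - 4)}, {g (i - 4), g (i + d + 4)}}"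
      by (rule P4dec_path)
    moreover have "{g (i + d), g (i - 4)} = E (i - 4) (d + 4)"
      "{g (i - 4), g (i + d + 4)} = E (i - 4) (d + 8)"
      unfolding E_def by (simp_all add: insert_commute algebra_simps)
    ultimately show ?thesis unfolding S_def E_def[of i] by simp
  qed
  have "disjoint_family_on S {0..<v}"
  proof (rule disjoint_familyI)
    fix i j e assume ij: "i \<in> {0..<v}" "j \<in> {0..<v}" and e: "e \<in> S i" "e \<in> S j"
    have "v dvd i - j"
      using e assms unfolding S_def by (auto simp: E_eq)
    then show "i = j" by (rule same_index[OF ij])
  qed
  then have "P4dec (\<Union>i\<in>{0..<v}. S i)" using path by (intro P4dec_Union) auto
  also have "(\<Union>i\<in>{0..<v}. S i) = D d \<union> D (d + 4) \<union> D (d + 8)"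
    unfolding D_eq[of d] D_shift[of "d + 4" "- 4"] D_shift[of "d + 8" "- 4"] S_def by auto
  finally show ?thesis .
qed

lemma P4dec_classes:
  assumes "0 \<le> m" "m + 3 * int q \<le> k"
  shows "P4dec (\<Union>j\<in>{m..<m + 3 * int q}. D (4 * j + 1))"
  using assms(2)
proof (induction q)
  case (Suc q)
  let ?j = "m + 3 * int q"
  have split: "{m..<m + 3 * int (Suc q)} = {m..<?j} \<union> {?j, ?j + 1, ?j + 2}" by auto
  have "P4dec (D (4 * ?j + 1) \<union> D (4 * ?j + 1 + 4) \<union> D (4 * ?j + 1 + 8))"
    using Suc.prems assms(1) by (intro P4dec_three_classes) auto
  moreover have "(\<Union>j\<in>{?j, ?j + 1, ?j + 2}. D (4 * j + 1)) =
      D (4 * ?j + 1) \<union> D (4 * ?j + 1 + 4) \<union> D (4 * ?j + 1 + 8)"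
    by (simp add: Un_assoc algebra_simps)
  ultimately have P: "P4dec (\<Union>j\<in>{?j, ?j + 1, ?j + 2}. D (4 * j + 1))" by simp
  have "(\<Union>j\<in>{m..<?j}. D (4 * j + 1)) \<inter> (\<Union>j\<in>{?j, ?j + 1, ?j + 2}. D (4 * j + 1)) = {}"
  proof -
    have "D (4 * a + 1) \<inter> D (4 * b + 1) = {}" if "a \<in> {m..<?j}" "b \<in> {?j, ?j + 1, ?j + 2}" for a b
      using that Suc.prems assms(1) by (intro D_disjoint) auto
    then show ?thesis by blast
  qed
  then have "P4dec ((\<Union>j\<in>{m..<?j}. D (4 * j + 1)) \<union> (\<Union>j\<in>{?j, ?j + 1, ?j + 2}. D (4 * j + 1)))"
    using P Suc by (intro P4dec_Un) auto
  then show ?case unfolding split UN_Un .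
qed (simp add: P4dec_empty)

lemma absorbs_BB:
  assumes "P4dec ((\<Union>j\<in>{0..<k}. D (4 * j + 1)) \<union> F)"
  shows "absorbs BB F"
  unfolding BB_def
proof (rule absorbs_imageI[OF inj_block])
  let ?c = "\<lambda>(j, i). E i (4 * j + 1)"
  show "?c x \<in> block x" if "x \<in> I" for x
    by (cases x) (simp add: block_edges E_def add.assoc)
  have "?c ` I = (\<Union>j\<in>{0..<k}. D (4 * j + 1))" unfolding D_eq by auto
  then show "P4dec (?c ` I \<union> F)" using assms by simp
qed

text \<open>The classes set aside are those of smallest difference, to be decomposed together with
  the outer edges \<open>F\<close>; the other classes go in triples.\<close>

lemma absorbs_BB_leftover:
  assumes "0 \<le> m" "m + 3 * int q = k" "P4dec ((\<Union>j\<in>{0..<m}. D (4 * j + 1)) \<union> F)"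
    and F: "F \<inter> clique V = {}"
  shows "absorbs BB F"
proof (rule absorbs_BB)
  let ?D = "\<lambda>J. \<Union>j\<in>J. D (4 * j + 1)"
  have split: "{0..<k} = {0..<m} \<union> {m..<m + 3 * int q}" using assms(1,2) by auto
  have "D (4 * a + 1) \<inter> D (4 * b + 1) = {}" if "a \<in> {0..<m}" "b \<in> {m..<m + 3 * int q}" for a b
    using that assms(1,2) by (intro D_disjoint) auto
  moreover have "D (4 * b + 1) \<subseteq> clique V" if "b \<in> {m..<m + 3 * int q}" for b
    using that assms(1,2) unfolding D_def by (auto intro!: E_in_clique)
  ultimately have "(?D {0..<m} \<union> F) \<inter> ?D {m..<m + 3 * int q} = {}"
    using F by blast
  then have "P4dec ((?D {0..<m} \<union> F) \<union> ?D {m..<m + 3 * int q})"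
    using assms(1,2) by (intro P4dec_Un[OF assms(3)] P4dec_classes) simp_all
  then show "P4dec (?D {0..<k} \<union> F)" unfolding split UN_Un by (simp only: Un_ac)
qed

text \<open>The class of difference 1 is a cycle through all of \<open>V\<close>. Its length is a
  multiple of 3, so it can be cut into stretches of three edges.\<close>

lemma P4dec_cycle:
  assumes "v = 3 * w"
  shows "P4dec (D 1)"
proof -
  define S where "S i = (\<lambda>a. E (3 * i + a) 1) ` {0..2}" for i
  have path: "P4dec (S i)" for i
  proof -
    have "distinct [g (3 * i), g (3 * i + 1), g (3 * i + 2), g (3 * i + 3)]"
      using g_neq[of "3 * i" "3 * i + 1"] g_neq[of "3 * i" "3 * i + 2"] g_neq[of "3 * i" "3 * i + 3"]
        g_neq[of "3 * i + 1" "3 * i + 2"] g_neq[of "3 * i + 1" "3 * i + 3"]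
        g_neq[of "3 * i + 2" "3 * i + 3"] k by simp
    then have "P4dec {{g (3 * i), g (3 * i + 1)}, {g (3 * i + 1), g (3 * i + 2)},
        {g (3 * i + 2), g (3 * i + 3)}}" by (rule P4dec_path)
    moreover have "S i = {{g (3 * i), g (3 * i + 1)}, {g (3 * i + 1), g (3 * i + 2)},
        {g (3 * i + 2), g (3 * i + 3)}}"
      unfolding S_def atLeastAtMost_0_2 E_def by (simp add: add.assoc)
    ultimately show ?thesis by simp
  qed
  have "disjoint_family_on S {0..<w}"
  proof (rule disjoint_familyI)
    fix i j e assume ij: "i \<in> {0..<w}" "j \<in> {0..<w}" and e: "e \<in> S i" "e \<in> S j"
    then obtain a b where ab: "a \<in> {0..2}" "b \<in> {0..2}" "E (3 * i + a) 1 = E (3 * j + b) 1"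
      unfolding S_def by blast
    then have "v dvd (3 * i + a) - (3 * j + b)" using k by (simp add: E_eq)
    then have "3 * i + a = 3 * j + b"
      using ij ab(1,2) assms by (intro same_index) auto
    then show "i = j" using ab(1,2) by auto
  qed
  then have "P4dec (\<Union>i\<in>{0..<w}. S i)" using path by (intro P4dec_Union) auto
  also have "(\<Union>i\<in>{0..<w}. S i) = D 1"
    using three_intervals_image[of "\<lambda>i. E i 1" w] unfolding D_eq assms S_def .
  finally show ?thesis .
qed

lemma E_subset_V: "E i d \<subseteq> V"
  unfolding E_def V_def by simp

text \<open>Three consecutive rim vertices contribute three spokes to the hub \<open>z\<close> and
  three rim edges, which form two paths.\<close>

lemma P4dec_wheel:
  assumes w: "v = 3 * w" and z: "z \<notin> V"
  shows "P4dec (D 1 \<union> join {z} V)"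
proof -
  define S where "S i = (\<lambda>a. E (3 * i + a) 1) ` {0..2} \<union> (\<lambda>a. {z, g (3 * i + a)}) ` {0..2}" for i
  have z_neq: "z \<noteq> g i" for i using z unfolding V_def by auto
  have path: "P4dec (S i)" for i
  proof -
    let ?s = "3 * i"
    have neq: "distinct [g ?s, g (?s + 1), g (?s + 2), g (?s + 3)]"
      using g_neq[of ?s "?s + 1"] g_neq[of ?s "?s + 2"] g_neq[of ?s "?s + 3"]
        g_neq[of "?s + 1" "?s + 2"] g_neq[of "?s + 1" "?s + 3"]
        g_neq[of "?s + 2" "?s + 3"] k by simp
    have S: "S i = set (concat (map path_edges
        [(z, g ?s, g (?s + 1), g (?s + 2)), (g (?s + 1), z, g (?s + 2), g (?s + 3))]))"
    proof -
      have "S i = {{g ?s, g (?s + 1)}, {g (?s + 1), g (?s + 2)}, {g (?s + 2), g (?s + 3)},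
          {z, g ?s}, {z, g (?s + 1)}, {z, g (?s + 2)}}"
        unfolding S_def atLeastAtMost_0_2 E_def
        by (simp add: add.assoc) (simp only: insert_commute)
      then show ?thesis by (simp add: insert_commute)
    qed
    show ?thesis
      by (rule P4dec_pathsI[OF S[symmetric]]) (use neq z_neq in \<open>auto simp: doubleton_eq_iff\<close>)
  qed
  have "disjoint_family_on S {0..<w}"
  proof (rule disjoint_familyI)
    fix i j e assume ij: "i \<in> {0..<w}" "j \<in> {0..<w}" and e: "e \<in> S i" "e \<in> S j"
    have zE: "E x 1 \<noteq> {z, y}" for x y using E_subset_V[of x 1] z by blast
    obtain a b where ab: "a \<in> {0..2}" "b \<in> {0..2}"
      and "E (3 * i + a) 1 = E (3 * j + b) 1 \<or> {z, g (3 * i + a)} = {z, g (3 * j + b)}"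
    proof -
      have *: "\<exists>a\<in>{0..2}. e = E (3 * x + a) 1 \<or> e = {z, g (3 * x + a)}" if "e \<in> S x" for x
        using that unfolding S_def by blast
      obtain a b where ab: "a \<in> {0..2}" "b \<in> {0..2}"
        and a: "e = E (3 * i + a) 1 \<or> e = {z, g (3 * i + a)}"
        and b: "e = E (3 * j + b) 1 \<or> e = {z, g (3 * j + b)}"
        using *[OF e(1)] *[OF e(2)] by blast
      have "E (3 * i + a) 1 = E (3 * j + b) 1 \<or> {z, g (3 * i + a)} = {z, g (3 * j + b)}"
        using a b zE by metis
      then show ?thesis using that ab by blast
    qed
    then have "v dvd (3 * i + a) - (3 * j + b)"
      using k z_neq by (auto simp: E_eq doubleton_eq_iff g_eq)
    then have "3 * i + a = 3 * j + b"
      using ij ab w by (intro same_index) auto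
    then show "i = j" using ab by auto
  qed
  then have "P4dec (\<Union>i\<in>{0..<w}. S i)" using path by (intro P4dec_Union) auto
  also have "(\<Union>i\<in>{0..<w}. S i) = D 1 \<union> join {z} V"
  proof -
    have "join {z} V = (\<lambda>i. {z, g i}) ` {0..<v}"
      unfolding V_eq by (simp add: join_insert image_image)
    then show ?thesis
      using three_intervals_image[of "\<lambda>i. E i 1" w] three_intervals_image[of "\<lambda>i. {z, g i}" w]
      unfolding S_def D_eq w by (simp only: UN_Un_distrib)
  qed
  finally show ?thesis .
qed

text \<open>The paths are the translates of z, 0, 1, -4, which use one spoke and the differences 1
  and 5; \<open>k \<ge> 2\<close> puts 5 within the range \<open>4 * k\<close>.\<close>

lemma P4dec_two_classes_wheel:
  assumes "k \<ge> 2" and z: "z \<notin> V"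
  shows "P4dec (D 1 \<union> D 5 \<union> join {z} V)"
proof -
  define S where "S i = {{z, g i}, E i 1, E (i - 4) 5}" for i
  have z_neq: "z \<noteq> g i" for i using z unfolding V_def by auto
  have path: "P4dec (S i)" for i
  proof -
    have "distinct [z, g i, g (i + 1), g (i - 4)]"
      using g_neq[of i "i + 1"] g_neq[of i "i - 4"] g_neq[of "i + 1" "i - 4"] assms(1) z_neq by simp
    then have "P4dec {{z, g i}, {g i, g (i + 1)}, {g (i + 1), g (i - 4)}}"
      by (rule P4dec_path)
    moreover have "{g (i + 1), g (i - 4)} = E (i - 4) 5"
      unfolding E_def by (simp add: insert_commute add.commute)
    ultimately show ?thesis unfolding S_def E_def[of i] by simp
  qed
  have "disjoint_family_on S {0..<v}"
  proof (rule disjoint_familyI)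
    fix i j e assume ij: "i \<in> {0..<v}" "j \<in> {0..<v}" and e: "e \<in> S i" "e \<in> S j"
    have zE: "E x d \<noteq> {z, y}" "{z, y} \<noteq> E x d" for x y d using E_subset_V[of x d] z by blast+
    have "v dvd i - j"
      using e assms(1) zE z_neq unfolding S_def by (auto simp: E_eq doubleton_eq_iff g_eq)
    then show "i = j" by (rule same_index[OF ij])
  qed
  then have "P4dec (\<Union>i\<in>{0..<v}. S i)" using path by (intro P4dec_Union) auto
  also have "(\<Union>i\<in>{0..<v}. S i) = D 1 \<union> D 5 \<union> join {z} V"
    unfolding D_eq[of 1] D_shift[of 5 "- 4"] V_eq S_def by (auto simp: join_insert)
  finally show ?thesis .
qed

text \<open>The hypothesis rules out \<open>k mod 3 = 2\<close>. So at most one class is left over,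
  and if one is, then 3 divides \<open>v\<close> and its cycle can be cut up.\<close>

lemma absorbs_order:
  assumes "v mod 3 \<noteq> 2"
  shows "absorbs BB {}"
proof -
  have "k mod 3 = 0 \<or> k mod 3 = 1" using assms by presburger
  then show ?thesis
  proof
    assume "k mod 3 = 0"
    then have "0 + 3 * int (nat (k div 3)) = k" using k by auto
    then show ?thesis by (rule absorbs_BB_leftover[rotated]) (simp_all add: P4dec_empty)
  next
    assume "k mod 3 = 1"
    then have "1 + 3 * int (nat (k div 3)) = k" using k by simp presburger
    moreover have "P4dec (D 1)" using \<open>k mod 3 = 1\<close> by (intro P4dec_cycle[of "v div 3"]) presburger
    moreover have "{0..<1 :: int} = {0}" by auto
    ultimately show ?thesis by (intro absorbs_BB_leftover[of 1 "nat (k div 3)"]) simp_all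
  qed
qed

text \<open>Now one or two classes are left over, and in either case the spokes at \<open>z\<close>
  complete them.\<close>

lemma absorbs_order_plus_1:
  assumes "v mod 3 \<noteq> 1" and z: "z \<notin> V"
  shows "absorbs BB (join {z} V)"
proof -
  have F: "join {z} V \<inter> clique V = {}"
    using z unfolding clique_def by (auto simp: mem_join)
  have "k mod 3 = 1 \<or> k mod 3 = 2" using assms(1) by presburger
  then show ?thesis
  proof
    assume "k mod 3 = 1"
    then have "1 + 3 * int (nat (k div 3)) = k" using k by simp presburger
    moreover have "P4dec (D 1 \<union> join {z} V)"
      using \<open>k mod 3 = 1\<close> z by (intro P4dec_wheel[of "v div 3"]) presburger+
    moreover have "{0..<1 :: int} = {0}" by auto
    ultimately show ?thesis using F by (intro absorbs_BB_leftover[of 1 "nat (k div 3)"]) simp_all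
  next
    assume k2: "k mod 3 = 2"
    then have "2 + 3 * int (nat (k div 3)) = k" using k by simp presburger
    moreover have "P4dec (D 1 \<union> D 5 \<union> join {z} V)"
      using k2 k z by (intro P4dec_two_classes_wheel) presburger+
    moreover have "{0..<2 :: int} = {0, 1}" by auto
    ultimately show ?thesis using F by (intro absorbs_BB_leftover[of 2 "nat (k div 3)"]) simp_all
  qed
qed

end

section \<open>Designs as sets of graphs\<close>

lemma isomorphicE:
  assumes "isomorphic G H" "simple_graph G"
  obtains h where "bij_betw h (verts H) (verts G)" "edges G = (\<lambda>e. h ` e) ` edges H"
proof -
  obtain f where f: "bij_betw f (verts G) (verts H)" "edges H = (\<lambda>e. f ` e) ` edges G"
    using assms(1) unfolding isomorphic_def by blast
  let ?h = "inv_into (verts G) f"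
  have "?h ` (f ` e) = e" if "e \<in> edges G" for e
  proof -
    have "e \<subseteq> verts G" using assms(2) that unfolding simple_graph_def by blast
    then show ?thesis using f(1) by (simp add: bij_betw_def inv_into_image_cancel)
  qed
  then have "edges G = (\<lambda>e. ?h ` e) ` edges H" unfolding f(2) image_image by simp
  then show ?thesis using that bij_betw_inv_into[OF f(1)] by blast
qed

lemma isomorphicI:
  assumes h: "bij_betw h (verts H) (verts G)" and e: "edges G = (\<lambda>e. h ` e) ` edges H"
    and sub: "\<And>e. e \<in> edges H \<Longrightarrow> e \<subseteq> verts H"
  shows "isomorphic G H"
  unfolding isomorphic_def
proof (intro exI conjI)
  let ?f = "inv_into (verts H) h"
  show "bij_betw ?f (verts G) (verts H)" by (rule bij_betw_inv_into[OF h])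
  have "?f ` (h ` e) = e" if "e \<in> edges H" for e
    using sub[OF that] h by (simp add: bij_betw_def inv_into_image_cancel)
  then show "edges H = (\<lambda>e. ?f ` e) ` edges G" unfolding e image_image by simp
qed

lemma edges_P4: "edges P4 = {{0, 1}, {1, 2}, {2, 3}}"
proof -
  have "edges P4 = (\<lambda>i. {i, Suc i}) ` {..<3}"
    unfolding path_graph_def by auto
  also have "{..<3 :: nat} = {0, 1, 2}" by auto
  finally show ?thesis by (simp add: numeral_2_eq_2 numeral_3_eq_3)
qed

lemma edges_C4: "edges C4 = {{0, 1}, {1, 2}, {2, 3}, {3, 0}}"
proof -
  have "edges C4 = (\<lambda>i. {i, Suc i mod 4}) ` {..<4}"
    unfolding cycle_graph_def by auto
  also have "{..<4 :: nat} = {0, 1, 2, 3}" by auto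
  finally have "edges C4 = {{0, Suc 0}, {Suc 0, Suc (Suc 0)}, {2, 3}, {3, 0}}" by simp
  then show ?thesis by (simp only: One_nat_def numeral_2_eq_2)
qed

lemma verts_P4_C4: "verts P4 = {..<4}" "verts C4 = {..<4}"
  by (simp_all add: path_graph_def cycle_graph_def)

lemma four_vertices:
  fixes h :: "nat \<Rightarrow> 'a"
  assumes "bij_betw h {..<4} A"
  shows "distinct [h 0, h 1, h 2, h 3]" "A = {h 0, h 1, h 2, h 3}"
proof -
  have eq: "{..<4 :: nat} = {0, 1, 2, 3}" by auto
  show "A = {h 0, h 1, h 2, h 3}"
    using bij_betw_imp_surj_on[OF assms] unfolding eq by (simp only: image_insert image_empty)
  have "distinct [0, 1, 2, 3 :: nat]" by simp
  moreover have "set [0, 1, 2, 3 :: nat] = {..<4}" by auto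
  ultimately have "distinct (map h [0, 1, 2, 3])"
    using bij_betw_imp_inj_on[OF assms] by (simp only: distinct_map)
  then show "distinct [h 0, h 1, h 2, h 3]" by (simp only: list.map)
qed

lemma isomorphic_C4D:
  assumes "isomorphic G C4" "simple_graph G"
  shows "is_C4 (edges G)" "verts G = \<Union>(edges G)" "card (verts G) = 4"
proof -
  obtain h where h: "bij_betw h {..<4} (verts G)" and e: "edges G = (\<lambda>e. h ` e) ` edges C4"
    using isomorphicE[OF assms] unfolding verts_P4_C4 .
  have e': "edges G = {{h 0, h 1}, {h 1, h 2}, {h 2, h 3}, {h 3, h 0}}"
    unfolding e edges_C4 by simp
  show "is_C4 (edges G)" unfolding is_C4_def e'
    by (intro exI conjI) (rule four_vertices(1)[OF h], rule refl)
  show "verts G = \<Union>(edges G)" unfolding e' four_vertices(2)[OF h] by auto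
  show "card (verts G) = 4" using bij_betw_same_card[OF h] by simp
qed

lemma isomorphic_P4D:
  assumes "isomorphic G P4" "simple_graph G"
  shows "is_P4 (edges G)" "card (verts G) = 4"
proof -
  obtain h where h: "bij_betw h {..<4} (verts G)" and e: "edges G = (\<lambda>e. h ` e) ` edges P4"
    using isomorphicE[OF assms] unfolding verts_P4_C4 .
  have e': "edges G = {{h 0, h 1}, {h 1, h 2}, {h 2, h 3}}"
    unfolding e edges_P4 by simp
  show "is_P4 (edges G)" unfolding e' by (rule is_P4I[OF four_vertices(1)[OF h]])
  show "card (verts G) = 4" using bij_betw_same_card[OF h] by simp
qed

text \<open>Neither \<open>P4\<close> nor \<open>C4\<close> has isolated vertices, so blocks can be
  built from their edge sets alone.\<close>

definition edge_graph :: "'a set set \<Rightarrow> 'a graph" where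
  "edge_graph P = \<lparr>verts = \<Union>P, edges = P\<rparr>"

lemma edge_graph_sel [simp]: "verts (edge_graph P) = \<Union>P" "edges (edge_graph P) = P"
  by (simp_all add: edge_graph_def)

lemma bij_betw_nth4:
  assumes "distinct [a, b, c, d]"
  shows "bij_betw ((!) [a, b, c, d]) {..<4} {a, b, c, d}"
  by (rule bij_betw_nth[OF assms]) auto

lemma isomorphic_P4I:
  assumes "is_P4 P"
  shows "isomorphic (edge_graph P) P4"
proof -
  obtain a b c d where d: "distinct [a, b, c, d]" and P: "P = {{a, b}, {b, c}, {c, d}}"
    using assms unfolding is_P4_def by (elim exE conjE)
  show ?thesis
  proof (rule isomorphicI[of "(!) [a, b, c, d]"])
    have "\<Union>P = {a, b, c, d}" unfolding P by auto
    then show "bij_betw ((!) [a, b, c, d]) (verts P4) (verts (edge_graph P))"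
      using bij_betw_nth4[OF d] by (simp add: verts_P4_C4)
    show "edges (edge_graph P) = (\<lambda>e. (!) [a, b, c, d] ` e) ` edges P4"
      unfolding edges_P4 P by (simp add: numeral_2_eq_2 numeral_3_eq_3)
    show "e \<subseteq> verts P4" if "e \<in> edges P4" for e
      using that unfolding edges_P4 verts_P4_C4 by auto
  qed
qed

lemma isomorphic_C4I:
  assumes "is_C4 B"
  shows "isomorphic (edge_graph B) C4"
proof -
  obtain a b c d where d: "distinct [a, b, c, d]" and B: "B = {{a, b}, {b, c}, {c, d}, {d, a}}"
    using is_C4E[OF assms] .
  show ?thesis
  proof (rule isomorphicI[of "(!) [a, b, c, d]"])
    have "\<Union>B = {a, b, c, d}" unfolding B by auto
    then show "bij_betw ((!) [a, b, c, d]) (verts C4) (verts (edge_graph B))"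
      using bij_betw_nth4[OF d] by (simp add: verts_P4_C4)
    show "edges (edge_graph B) = (\<lambda>e. (!) [a, b, c, d] ` e) ` edges C4"
      unfolding edges_C4 B by (simp add: numeral_2_eq_2 numeral_3_eq_3)
    show "e \<subseteq> verts C4" if "e \<in> edges C4" for e
      using that unfolding edges_C4 verts_P4_C4 by auto
  qed
qed

lemma complete_graph_sel [simp]:
  "verts (complete_graph V) = V" "edges (complete_graph V) = clique V"
  by (simp_all add: complete_graph_def clique_def)

lemma subgraph_edge_graph:
  assumes "finite W" "P \<subseteq> clique W"
  shows "subgraph (edge_graph P) (complete_graph W)"
proof -
  have "\<Union>P \<subseteq> W" "\<forall>e\<in>P. card e = 2" using assms(2) unfolding clique_def by auto
  then show ?thesis
    using assms finite_subset[of "\<Union>P" W] unfolding subgraph_def simple_graph_def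
    by (auto simp: clique_def)
qed

lemma is_design_edge_graphs:
  assumes W: "finite W" and ne: "PP \<noteq> {}"
    and iso: "\<And>P. P \<in> PP \<Longrightarrow> isomorphic (edge_graph P) \<Gamma>"
    and disj: "disjoint PP" and U: "\<Union>PP = clique W"
  shows "is_design (complete_graph W) \<Gamma> (edge_graph ` PP)"
  unfolding is_design_def
proof (intro conjI)
  have sub: "subgraph (edge_graph P) (complete_graph W)" if "P \<in> PP" for P
    using subgraph_edge_graph[OF W] that U by blast
  then show "\<forall>B\<in>edge_graph ` PP. subgraph B (complete_graph W) \<and> isomorphic B \<Gamma>"
    using iso by blast
  then show "embeds \<Gamma> (complete_graph W)" using ne unfolding embeds_def by blast
  show "disjoint_family_on edges (edge_graph ` PP)"
  proof (rule disjoint_familyI)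
    fix G H e assume "G \<in> edge_graph ` PP" "H \<in> edge_graph ` PP" "e \<in> edges G" "e \<in> edges H"
    then obtain P Q where "P \<in> PP" "Q \<in> PP" "G = edge_graph P" "H = edge_graph Q" "e \<in> P \<inter> Q"
      by auto
    then show "G = H" using disj unfolding disjoint_def by fast
  qed
  show "(\<Union>B\<in>edge_graph ` PP. edges B) = edges (complete_graph W)" using U by simp
qed

lemma design_block:
  assumes "is_design K \<Gamma> \<B>" "B \<in> \<B>"
  shows "subgraph B K" "isomorphic B \<Gamma>"
  using assms unfolding is_design_def by blast+

lemma disjoint_edges:
  assumes "is_design K \<Gamma> \<B>"
  shows "disjoint (edges ` \<B>)"
proof -
  have "edges A \<inter> edges B = {}" if "A \<in> \<B>" "B \<in> \<B>" "edges A \<noteq> edges B" for A B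
    using assms that unfolding is_design_def disjoint_family_on_def by metis
  then show ?thesis unfolding disjoint_def by blast
qed

lemma c4_designI:
  assumes V: "finite V" "card V > 1" and \<B>: "is_design (complete_graph V) C4 \<B>"
  shows "c4_design V (edges ` \<B>)"
proof
  note sub = design_block[OF \<B>]
  show cover: "\<Union>(edges ` \<B>) = clique V" using \<B> unfolding is_design_def by simp
  have "finite (clique V)" using V(1) unfolding clique_def by simp
  then show "finite (edges ` \<B>)" unfolding cover[symmetric] by (rule finite_UnionD)
  show "is_C4 B" if "B \<in> edges ` \<B>" for B
    using that sub isomorphic_C4D(1) unfolding subgraph_def by blast
  show "\<Union>B \<subseteq> V" if "B \<in> edges ` \<B>" for B
    using that cover unfolding clique_def by blast
  show "disjoint (edges ` \<B>)" by (rule disjoint_edges[OF \<B>])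
qed (rule V)+

lemma (in c4_design) design_edge_graphs: "is_design (complete_graph V) C4 (edge_graph ` BB)"
proof -
  have "clique V \<noteq> {}"
  proof -
    obtain T where "T \<subseteq> V" "card T = 2" using card_V obtain_subset_with_card_n[of 2 V] by auto
    then show ?thesis unfolding clique_def by blast
  qed
  then have "BB \<noteq> {}" using cover by auto
  then show ?thesis
    using finite_V disj cover isomorphic_C4I[OF C4] by (intro is_design_edge_graphs)
qed

text \<open>The path design consists of the truncated blocks (\<open>QQ\<close>), which are the
  images under the down-link, and of the paths made from deleted and new edges
  (\<open>PP\<close>).\<close>

lemma down_linked_if_absorbs:
  assumes V: "finite V" "card V > 1" and \<B>: "is_design (complete_graph V) C4 \<B>"
    and W: "finite W" "V \<subseteq> W" and abs: "absorbs (edges ` \<B>) (clique W - clique V)"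
  shows "\<exists>\<B>'. design_of_order (card W) P4 \<B>' \<and> down_linked \<B> \<B>'"
proof -
  let ?BB = "edges ` \<B>"
  interpret c4_design V ?BB by (rule c4_designI[OF V \<B>])
  obtain e where e: "\<And>B. B \<in> ?BB \<Longrightarrow> e B \<in> B" "P4dec (e ` ?BB \<union> (clique W - clique V))"
    using abs unfolding absorbs_def by blast
  obtain PP where PP: "\<forall>P\<in>PP. is_P4 P" "disjoint PP"
    "\<Union>PP = e ` ?BB \<union> (clique W - clique V)"
    using P4dec_partition[OF e(2)] .
  define QQ where "QQ = (\<lambda>B. B - {e B}) ` ?BB"
  have VW: "clique V \<subseteq> clique W" using W(2) unfolding clique_def by blast
  have UQ: "\<Union>QQ = clique V - e ` ?BB"
  proof (intro equalityI subsetI)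
    fix x assume "x \<in> \<Union>QQ"
    then obtain B where B: "B \<in> ?BB" "x \<in> B" "x \<noteq> e B" unfolding QQ_def by blast
    have "x \<noteq> e D" if "D \<in> ?BB" for D
      using block_unique[OF B(2) _ B(1) that] e(1)[OF that] B(3) by metis
    then show "x \<in> clique V - e ` ?BB" using B(1,2) cover by blast
  next
    fix x assume x: "x \<in> clique V - e ` ?BB"
    then have "x \<in> \<Union>?BB" unfolding cover by simp
    then obtain B where B: "B \<in> ?BB" "x \<in> B" by (rule UnionE)
    have "e B \<in> e ` ?BB" using B(1) by (rule imageI)
    then have "x \<in> B - {e B}" using x B(2) by auto
    then show "x \<in> \<Union>QQ" unfolding QQ_def by (rule UN_I[OF B(1)])
  qed
  have eV: "e ` ?BB \<subseteq> clique V" using e(1) cover by blast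
  have "disjoint (QQ \<union> PP)"
  proof (rule disjoint_union)
    show "disjoint QQ" unfolding disjoint_def
    proof (intro ballI impI)
      fix P Q assume "P \<in> QQ" "Q \<in> QQ" and ne: "P \<noteq> Q"
      obtain B where B: "B \<in> ?BB" "P = B - {e B}" using \<open>P \<in> QQ\<close> unfolding QQ_def by (rule imageE)
      obtain D where D: "D \<in> ?BB" "Q = D - {e D}" using \<open>Q \<in> QQ\<close> unfolding QQ_def by (rule imageE)
      have "B \<noteq> D" using ne B(2) D(2) by metis
      then have "B \<inter> D = {}" using disjointD[OF disj B(1) D(1)] by blast
      then show "P \<inter> Q = {}" unfolding B(2) D(2) by blast
    qed
    show "\<Union>QQ \<inter> \<Union>PP = {}" unfolding UQ PP(3) by blast
  qed (rule PP(2))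
  moreover have "\<Union>(QQ \<union> PP) = clique W"
    unfolding Union_Un_distrib UQ PP(3) using eV VW by blast
  moreover have "is_P4 P" if "P \<in> QQ \<union> PP" for P
    using that PP(1) C4_minus_edge(1)[OF C4 e(1)] unfolding QQ_def by blast
  moreover obtain q where "q \<in> \<B>"
    using order card_V card_blocks by fastforce
  then have "QQ \<union> PP \<noteq> {}" unfolding QQ_def by blast
  ultimately have "is_design (complete_graph W) P4 (edge_graph ` (QQ \<union> PP))"
    using W(1) isomorphic_P4I by (intro is_design_edge_graphs) blast+
  then have "design_of_order (card W) P4 (edge_graph ` (QQ \<union> PP))"
    unfolding design_of_order_def using W(1) by blast
  moreover have "down_link (\<lambda>B. edge_graph (edges B - {e (edges B)})) \<B> (edge_graph ` (QQ \<union> PP))"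
    unfolding down_link_def
  proof (intro ballI conjI)
    fix B assume B: "B \<in> \<B>"
    show "edge_graph (edges B - {e (edges B)}) \<in> edge_graph ` (QQ \<union> PP)"
      using B unfolding QQ_def by blast
    have "simple_graph B" using design_block(1)[OF \<B> B] unfolding subgraph_def by blast
    then show "subgraph (edge_graph (edges B - {e (edges B)})) B"
      unfolding subgraph_def simple_graph_def
      by (auto intro: finite_subset[of _ "verts B"])
  qed
  ultimately show ?thesis unfolding down_linked_def by blast
qed

section \<open>Necessary conditions on the order of the path design\<close>

lemma order_P4_design:
  assumes "design_of_order n P4 \<B>'"
  shows "n mod 3 = 0 \<or> n mod 3 = 1"
proof -
  obtain W where W: "finite W" "card W = n" and d: "is_design (complete_graph W) P4 \<B>'"
    using assms unfolding design_of_order_def by blast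
  let ?PP = "edges ` \<B>'"
  have U: "\<Union>?PP = clique W" using d unfolding is_design_def by simp
  have P4: "is_P4 P" if "P \<in> ?PP" for P
    using that design_block[OF d] isomorphic_P4D(1) unfolding subgraph_def by blast
  have "card (\<Union>?PP) = (\<Sum>P\<in>?PP. card P)"
  proof (rule card_Union_disjoint)
    show "pairwise disjnt ?PP"
      using disjoint_edges[OF d] unfolding disjoint_def pairwise_def disjnt_def .
    show "finite P" if "P \<in> ?PP" for P using P4[OF that] unfolding is_P4_def by auto
  qed
  also have "\<dots> = (\<Sum>P\<in>?PP. 3)"
  proof (rule sum.cong[OF refl])
    fix P assume "P \<in> ?PP"
    then show "card P = 3" using P4 P4_card unfolding is_P4_def by metis
  qed
  finally have "n choose 2 = 3 * card ?PP" unfolding U card_clique[OF W(1)] W(2) by simp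
  moreover have "even (n * (n - 1))" by (cases n) auto
  ultimately have "n * (n - 1) = 3 * (2 * card ?PP)"
    unfolding choose_two by (metis dvd_mult_div_cancel mult.left_commute)
  then have "(n * (n - 1)) mod 3 = 0" by simp
  moreover have "(n * (n - 1)) mod 3 = 2" if "n mod 3 = 2"
  proof -
    define q where "q = n div 3"
    have "n = 3 * q + 2" using that mult_div_mod_eq[of 3 n] unfolding q_def by simp
    then have "n * (n - 1) = 2 + 3 * (3 * q * q + 3 * q)" by (simp add: algebra_simps)
    then show ?thesis by (simp only: mod_mult_self2) simp
  qed
  ultimately have "n mod 3 \<noteq> 2" by linarith
  moreover have "n mod 3 < 3" by simp
  ultimately show ?thesis by linarith
qed

text \<open>In fact \<open>V \<subseteq> W\<close>: since \<open>v > 1\<close>, every vertex lies on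
  an edge and hence in a block, and the image of that block keeps all four vertices.\<close>

lemma order_le_if_down_linked:
  assumes "design_of_order v C4 \<B>" "v > 1" "design_of_order n P4 \<B>'" "down_linked \<B> \<B>'"
  shows "v \<le> n"
proof -
  obtain V where V: "finite V" "card V = v" and d: "is_design (complete_graph V) C4 \<B>"
    using assms(1) unfolding design_of_order_def by blast
  obtain W where W: "finite W" "card W = n" and d': "is_design (complete_graph W) P4 \<B>'"
    using assms(3) unfolding design_of_order_def by blast
  obtain f where f: "down_link f \<B> \<B>'" using assms(4) unfolding down_linked_def by blast
  have "V \<subseteq> W"
  proof
    fix q assume q: "q \<in> V"
    have "V \<noteq> {q}" using V assms(2) by auto
    then obtain p where "p \<in> V" "p \<noteq> q" using q by blast
    then have "{p, q} \<in> clique V" using q unfolding mem_clique by blast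
    then obtain B where B: "B \<in> \<B>" "{p, q} \<in> edges B" using d unfolding is_design_def by auto
    have fB: "f B \<in> \<B>'" "subgraph (f B) B" using f B(1) unfolding down_link_def by blast+
    have sB: "simple_graph B" "isomorphic B C4"
      using design_block[OF d B(1)] unfolding subgraph_def by blast+
    have fB': "subgraph (f B) (complete_graph W)" "isomorphic (f B) P4"
      using design_block[OF d' fB(1)] .
    have "card (verts (f B)) = card (verts B)"
      using isomorphic_C4D(3)[OF sB(2,1)] isomorphic_P4D(2)[OF fB'(2)] fB(2)
      unfolding subgraph_def by simp
    moreover have "verts (f B) \<subseteq> verts B" "finite (verts B)"
      using fB(2) unfolding subgraph_def simple_graph_def by blast+
    ultimately have "verts (f B) = verts B" by (metis card_subset_eq)
    moreover have "q \<in> verts B" using sB(1) B(2) unfolding simple_graph_def by blast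
    ultimately show "q \<in> W" using fB'(1) unfolding subgraph_def by auto
  qed
  then show ?thesis using V W card_mono by blast
qed

section \<open>The two spectra\<close>

lemma infinite_superset:
  fixes V :: "'a::infinite set"
  assumes "finite V" "card V \<le> n"
  obtains W where "finite W" "V \<subseteq> W" "card W = n"
proof -
  have "infinite (UNIV - V)" using assms(1) infinite_UNIV by (rule Diff_infinite_finite)
  then obtain X where X: "finite X" "card X = n - card V" "X \<subseteq> UNIV - V"
    using infinite_arbitrarily_large by metis
  have "card (V \<union> X) = n" using X assms by (subst card_Un_disjoint) auto
  then show ?thesis using that[of "V \<union> X"] X(1) assms(1) by blast
qed

lemma down_linked_if_order_ge:
  fixes \<B> :: "'a::infinite graph set"
  assumes "design_of_order v C4 \<B>" "v > 1" "n \<ge> v + 2" "n mod 3 = 0 \<or> n mod 3 = 1"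
  shows "\<exists>\<B>'. design_of_order n P4 \<B>' \<and> down_linked \<B> \<B>'"
proof -
  obtain V where V: "finite V" "card V = v" and d: "is_design (complete_graph V) C4 \<B>"
    using assms(1) unfolding design_of_order_def by blast
  have V1: "card V > 1" using V(2) assms(2) by simp
  obtain W where W: "finite W" "V \<subseteq> W" "card W = n"
    using infinite_superset[of V n] V assms(3) by auto
  have "absorbs (edges ` \<B>) (clique W - clique V)"
    using c4_design.absorbs_clique[OF c4_designI[OF V(1) V1 d] W(1,2)] W(3) V(2) assms(3,4) by simp
  then show ?thesis using down_linked_if_absorbs[OF V(1) V1 d W(1,2)] W(3) by simp
qed

lemma (in c4_design) down_linked_edge_graphs:
  assumes "finite W" "V \<subseteq> W" "absorbs BB (clique W - clique V)"
  shows "\<exists>\<B>'. design_of_order (card W) P4 \<B>' \<and> down_linked (edge_graph ` BB) \<B>'"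
proof (rule down_linked_if_absorbs[OF finite_V card_V design_edge_graphs assms(1,2)])
  have "edges ` edge_graph ` BB = BB" by (simp add: image_image)
  then show "absorbs (edges ` edge_graph ` BB) (clique W - clique V)" using assms(3) by simp
qed

lemma cyclic_design_down_linked:
  assumes v: "v = 8 * k + 1" "k > 0" and n: "n = v \<or> n = v + 1" "n mod 3 = 0 \<or> n mod 3 = 1"
  shows "\<exists>(\<B> :: 'a::infinite graph set) \<B>'.
    design_of_order v C4 \<B> \<and> design_of_order n P4 \<B>' \<and> down_linked \<B> \<B>'"
proof -
  obtain f :: "nat \<Rightarrow> 'a" where f: "inj f"
    using infinite_countable_subset[OF infinite_UNIV] by blast
  define m where "m = 8 * int k + 1"
  \<comment> \<open>The residues are labelled by \<open>f 0\<close> up to \<open>f (v - 1)\<close>,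
    so that \<open>f v\<close> is free to serve as the additional vertex.\<close>
  define g where "g i = f (nat (i mod m))" for i
  have m: "m > 0" "int v = m" "nat m = v" unfolding m_def v by auto
  interpret cyclic g "int k"
  proof
    show "1 \<le> int k" using v(2) by simp
    fix i j
    have "g i = g j \<longleftrightarrow> nat (i mod m) = nat (j mod m)"
      unfolding g_def using f by (simp add: inj_eq)
    also have "\<dots> \<longleftrightarrow> i mod m = j mod m" using m by (auto simp: eq_nat_nat_iff)
    also have "\<dots> \<longleftrightarrow> m dvd i - j" by (rule mod_eq_dvd_iff)
    finally show "g i = g j \<longleftrightarrow> 8 * int k + 1 dvd i - j" unfolding m_def .
  qed
  have cV: "card V = v" using card_V(1) m unfolding m_def by simp
  have zV: "f v \<notin> V"
  proof
    assume "f v \<in> V"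
    then obtain i where "f v = g i" unfolding V_def by blast
    then have "v = nat (i mod m)" using f unfolding g_def by (simp add: inj_eq)
    moreover have "i mod m < m" "0 \<le> i mod m" using m by simp_all
    ultimately show False using m by linarith
  qed
  have v3: "(8 * int k + 1) mod 3 = int (v mod 3)" using m(2) unfolding m_def by (simp add: zmod_int)
  have "\<exists>\<B>'. design_of_order n P4 \<B>' \<and> down_linked (edge_graph ` BB) \<B>'"
    using n(1)
  proof
    assume nv: "n = v"
    have "absorbs BB {}" using n(2) nv v3 by (intro absorbs_order) auto
    then have "absorbs BB (clique V - clique V)" by simp
    then show ?thesis using down_linked_edge_graphs[OF finite_V subset_refl] cV nv by simp
  next
    assume nv: "n = v + 1"
    have "v mod 3 \<noteq> 1" using n(2) nv by presburger
    then have "absorbs BB (join {f v} V)" using v3 zV by (intro absorbs_order_plus_1) auto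
    then have "absorbs BB (clique (V \<union> {f v}) - clique V)"
      using clique_extend_V[of "{f v}"] zV clique_insert[of "f v" "{}"] by simp
    moreover have "card (V \<union> {f v}) = n" using cV nv zV finite_V by simp
    ultimately show ?thesis
      using down_linked_edge_graphs[of "V \<union> {f v}"] finite_V by auto
  qed
  moreover have "design_of_order v C4 (edge_graph ` BB)"
    unfolding design_of_order_def using design_edge_graphs cV finite_V by blast
  ultimately show ?thesis by blast
qed

theorem theorem4p4:
  fixes v :: nat
  assumes "v > 1"
    and "\<exists>\<B> :: 'a::infinite graph set. design_of_order v C4 \<B>"
  shows "L1 TYPE('a) C4 v = {n. n \<ge> v \<and> (n mod 3 = 0 \<or> n mod 3 = 1)}
    \<and> {n. n \<ge> v + 2 \<and> (n mod 3 = 0 \<or> n mod 3 = 1)} \<subseteq> L2 TYPE('a) C4 v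
    \<and> L2 TYPE('a) C4 v \<subseteq> {n. n \<ge> v \<and> (n mod 3 = 0 \<or> n mod 3 = 1)}"
proof -
  obtain \<B> :: "'a graph set" where \<B>: "design_of_order v C4 \<B>" using assms(2) by blast
  then obtain V where V: "finite V" "card V = v" "is_design (complete_graph V) C4 \<B>"
    unfolding design_of_order_def by blast
  have V1: "card V > 1" using V(2) assms(1) by simp
  obtain k where k: "card V = 8 * k + 1" "k > 0"
    by (rule c4_design.order[OF c4_designI[OF V(1) V1 V(3)]])
  have k: "v = 8 * k + 1" "k > 0" using k V(2) by simp_all
  have L2: "{n. n \<ge> v + 2 \<and> (n mod 3 = 0 \<or> n mod 3 = 1)} \<subseteq> L2 TYPE('a) C4 v"
    unfolding L2_def
  proof (intro subsetI CollectI allI impI)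
    fix n and \<A> :: "'a graph set"
    assume n: "n \<in> {n. n \<ge> v + 2 \<and> (n mod 3 = 0 \<or> n mod 3 = 1)}" and "design_of_order v C4 \<A>"
    then show "\<exists>\<B>'. design_of_order n P4 \<B>' \<and> down_linked \<A> \<B>'"
      using assms(1) by (intro down_linked_if_order_ge[of v]) auto
  qed
  \<comment> \<open>This uses that a design of order \<open>v\<close> exists; otherwise membership
    in \<open>L2\<close> would be vacuous.\<close>
  have L2_L1: "L2 TYPE('a) C4 v \<subseteq> L1 TYPE('a) C4 v"
    using \<B> unfolding L1_def L2_def by blast
  have L1: "L1 TYPE('a) C4 v \<subseteq> {n. n \<ge> v \<and> (n mod 3 = 0 \<or> n mod 3 = 1)}"
    using order_le_if_down_linked[OF _ assms(1)] order_P4_design unfolding L1_def by blast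
  have "n \<in> L1 TYPE('a) C4 v" if n: "n \<ge> v" "n mod 3 = 0 \<or> n mod 3 = 1" for n
  proof (cases "n \<ge> v + 2")
    case True
    then have "n \<in> L2 TYPE('a) C4 v" using n(2) by (intro subsetD[OF L2]) simp
    then show ?thesis by (rule subsetD[OF L2_L1])
  next
    case False
    then have "n = v \<or> n = v + 1" using n(1) by linarith
    then show ?thesis
      using cyclic_design_down_linked[OF k _ n(2), where 'a = 'a] unfolding L1_def by simp
  qed
  then have "L1 TYPE('a) C4 v = {n. n \<ge> v \<and> (n mod 3 = 0 \<or> n mod 3 = 1)}"
    using L1 by (intro equalityI subsetI) auto
  then show ?thesis using L2 L2_L1 by simp
qed

end
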